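(* Let $A,B\subset\mathbb R^d$ be finite with $A\subset[B]$ and $\dim[B]=d$, let $k\ge2$ be an integer, and suppose $(A,B)$ is $k$-critical. Then: (i) $B\subset A$; (ii) $(A\cap[B'],B')$ is $k$-critical for every nonempty $B'\subset B$; (iii) $B$ is totally stackable, and thus $B$ is contained in the union of the edges of $[B]$; (iv) $(A,B)$ is $1$-critical, so $|A+B|=(d+1)|A|-d(d+1)/2$.
   Context: $[X]$ is the convex hull of $X$; $kB=B+\dots+B$ ($k$ summands). For finite $A,B$ with $B$ nonempty and $A\subset[B]$, with $q$ the dimension of the affine hull of $B$, the pair $(A,B)$ is $k$-critical if $|A+kB|={q+k\choose k}|A|-k{q+k\choose k+1}$. A triangulation of $B$ is a geometric simplicial complex with vertex set exactly $B$ and underlying space $[B]$; it is stacked if it has $|B|-\dim[B]$ full-dimensional simplices; $B$ is totally stackable if all its triangulations are stacked. *)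

theory Defs
  imports "HOL-Analysis.Analysis"
begin

text \<open>
  Set addition is Minkowski addition, so the sum of \<open>k\<close> copies of \<open>B\<close> is the
  iterated sumset, not the dilate of \<open>B\<close>. The identity is stated over the
  integers to avoid truncated subtraction.
\<close>

definition k_critical :: "nat \<Rightarrow> 'a::euclidean_space set \<Rightarrow> 'a set \<Rightarrow> bool" where
  "k_critical k A B \<longleftrightarrow>
     finite A \<and> finite B \<and> B \<noteq> {} \<and> A \<subseteq> convex hull B \<and>
     (let q = nat (aff_dim (affine hull B)) in
        int (card (A + (\<Sum>i<k. B))) =
          int ((q + k) choose k) * int (card A) - int k * int ((q + k) choose (k + 1)))"

text \<open>
  A simplicial complex of the library is closed under taking faces, hence its
  vertices are the points \<open>v\<close> for which \<open>{v}\<close> is a member.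
\<close>

definition triangulation_of :: "'a::euclidean_space set set \<Rightarrow> 'a set \<Rightarrow> bool" where
  "triangulation_of T B \<longleftrightarrow>
     simplicial_complex T \<and> {v. {v} \<in> T} = B \<and> \<Union>T = convex hull B"

definition stacked_triangulation :: "'a::euclidean_space set set \<Rightarrow> 'a set \<Rightarrow> bool" where
  "stacked_triangulation T B \<longleftrightarrow>
     triangulation_of T B \<and>
     int (card {S \<in> T. aff_dim S = aff_dim (convex hull B)}) =
       int (card B) - aff_dim (convex hull B)"

definition totally_stackable :: "'a::euclidean_space set \<Rightarrow> bool" where
  "totally_stackable B \<longleftrightarrow> (\<forall>T. triangulation_of T B \<longrightarrow> stacked_triangulation T B)"

end

theory Submission
  imports Defs
begin

text \<open>
  Lift \<open>x\<close> to \<open>(x, 1)\<close>, so that a triangulation of \<open>B\<close> becomes a family of bases \<open>V \<subseteq> B\<close> of the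
  linear span whose cones tile the cone over \<open>B\<close>. A generic direction \<open>p\<close> makes the tiling
  half-open: every \<open>x\<close> of the cone lies in exactly one cell \<open>V\<close> with \<open>x + \<epsilon>p\<close> in the interior of
  the cone over \<open>V\<close> for all small \<open>\<epsilon> > 0\<close>. The translates \<open>a + k cell(a)\<close> with \<open>a \<in> A\<close> lie in
  \<open>A + kB\<close>, and two of them can only meet when both base points are vertices of the cell
  containing \<open>p\<close>, since points of one unit simplex that are congruent modulo its vertices agree
  or are both vertices. Counting gives the lower bound for \<open>|A + kB|\<close>, and for a critical pair the
  union of these translates is all of \<open>A + kB\<close>, for every triangulation and every generic \<open>p\<close>.

  The claims follow by varying the triangulation and \<open>p\<close>. If \<open>p\<close> lies inside a cell, that cell is
  contained in \<open>A\<close>. Regular triangulations with one very high weight restrict to \<open>B - {b}\<close>, which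
  passes criticality on to subsets. If \<open>p\<close> had exactly two negative coordinates, at \<open>u\<close> and \<open>v\<close>, in
  a cell of some triangulation, then \<open>v + ku\<close> would be missing from the union; as positive
  coordinates of \<open>p\<close> can be created at will, \<open>p\<close> has at most one negative coordinate in every cell.
  Then each cell other than the one containing \<open>p\<close> is the cell of exactly one vertex, which counts
  the cells and rules out points of \<open>B\<close> in the relative interior of faces of dimension at least two.
\<close>

section \<open>Coordinates and nonnegative spans\<close>

text \<open>Extending \<open>V\<close> to a basis of the whole space makes coordinates linear everywhere, not only on
  the span of \<open>V\<close>.\<close>

definition coord :: "'a::euclidean_space set \<Rightarrow> 'a \<Rightarrow> 'a \<Rightarrow> real" where
  "coord V x v = real_vector.representation (real_vector.extend_basis V) x v"

lemma linear_coord: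
  assumes "independent V"
  shows "linear (\<lambda>x. coord V x v)"
proof -
  note ind = real_vector.independent_extend_basis[OF assms]
  note sp = real_vector.span_extend_basis[OF assms]
  show ?thesis
    unfolding coord_def
    by (rule linearI) (simp_all add: real_vector.representation_add[OF ind] real_vector.representation_scale[OF ind] sp)
qed

lemma coord_linear_simps:
  assumes "independent V"
  shows "coord V (x + y) v = coord V x v + coord V y v"
    and "coord V (x - y) v = coord V x v - coord V y v"
    and "coord V (- x) v = - coord V x v"
    and "coord V (c *\<^sub>R x) v = c * coord V x v"
    and "coord V 0 v = 0"
    and "coord V (sum f I) v = (\<Sum>i\<in>I. coord V (f i) v)"
  using linear_add[OF linear_coord[OF assms]] linear_diff[OF linear_coord[OF assms]]
    linear_neg[OF linear_coord[OF assms]] linear_scale[OF linear_coord[OF assms]]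
    linear_0[OF linear_coord[OF assms]] linear_sum[OF linear_coord[OF assms]]
  by auto

lemma coord_basis:
  assumes "independent V" "u \<in> V"
  shows "coord V u v = (if u = v then 1 else 0)"
  using real_vector.representation_basis[OF real_vector.independent_extend_basis[OF assms(1)], of u]
    real_vector.extend_basis_superset[OF assms(1)] assms(2)
  by (auto simp: coord_def)

lemma coord_sum_basis:
  assumes "independent V" "v \<in> V" "S \<subseteq> V"
  shows "coord V (\<Sum>u\<in>S. c u *\<^sub>R u) v = (if v \<in> S then c v else 0)"
proof -
  have fin: "finite S"
    using assms finiteI_independent finite_subset by blast
  have "coord V (\<Sum>u\<in>S. c u *\<^sub>R u) v = (\<Sum>u\<in>S. c u * coord V u v)"
    by (simp add: coord_linear_simps[OF assms(1)])
  also have "\<dots> = (\<Sum>u\<in>S. if u = v then c u else 0)"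
    using assms by (intro sum.cong) (auto simp: coord_basis)
  finally show ?thesis
    using fin by simp
qed

lemma coord_expand:
  assumes "independent V" "x \<in> span V"
  shows "(\<Sum>v\<in>V. coord V x v *\<^sub>R v) = x"
proof -
  have fin: "finite V"
    using assms finiteI_independent by blast
  obtain c where c: "x = (\<Sum>v\<in>V. c v *\<^sub>R v)"
    using assms(2) span_finite[OF fin] by auto
  show ?thesis
    unfolding c using coord_sum_basis[OF assms(1), of _ V c] by (intro sum.cong) auto
qed

text \<open>The bases extending \<open>V\<close> and \<open>W\<close> may differ, yet on the span of
  \<open>W\<close> both families of coordinates come from the same unique expansion.\<close>

lemma coord_subset:
  assumes "independent V" "W \<subseteq> V" "x \<in> span W" "v \<in> V"
  shows "coord V x v = (if v \<in> W then coord W x v else 0)"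
proof -
  have "independent W"
    using assms independent_mono by blast
  then have "coord V x v = coord V (\<Sum>w\<in>W. coord W x w *\<^sub>R w) v"
    using coord_expand assms by metis
  then show ?thesis
    using coord_sum_basis[OF assms(1,4,2)] by simp
qed

lemma coord_eq_0_span:
  assumes "independent V" "x \<in> span V" "W \<subseteq> V" "\<And>v. v \<in> V - W \<Longrightarrow> coord V x v = 0"
  shows "x \<in> span W"
proof -
  have "finite V" using assms finiteI_independent by blast
  then have "x = (\<Sum>v\<in>W. coord V x v *\<^sub>R v)"
    using coord_expand[OF assms(1,2)] sum.mono_neutral_left[of V W "\<lambda>v. coord V x v *\<^sub>R v"] assms(3,4)
    by auto
  also have "\<dots> \<in> span W"
    by (intro span_sum span_scale span_base)
  finally show ?thesis .
qed

lemma coord_inject: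
  assumes "independent V" "x \<in> span V" "y \<in> span V" "\<And>v. v \<in> V \<Longrightarrow> coord V x v = coord V y v"
  shows "x = y"
proof -
  have "(\<Sum>v\<in>V. coord V x v *\<^sub>R v) = (\<Sum>v\<in>V. coord V y v *\<^sub>R v)"
    using assms(4) by simp
  then show ?thesis
    using coord_expand assms by metis
qed

text \<open>For finite \<open>B\<close> this is the convex cone generated by \<open>B\<close>. For
  infinite \<open>B\<close> the sum defaults to 0 and only the zero vector is left.\<close>

definition nonneg_span :: "'a::euclidean_space set \<Rightarrow> 'a set" where
  "nonneg_span B = {x. \<exists>\<mu>. (\<forall>b\<in>B. 0 \<le> \<mu> b) \<and> x = (\<Sum>b\<in>B. \<mu> b *\<^sub>R b)}"

lemma nonneg_span_add:
  assumes "x \<in> nonneg_span B" "y \<in> nonneg_span B"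
  shows "x + y \<in> nonneg_span B"
proof -
  obtain \<mu> \<nu> where "\<forall>b\<in>B. 0 \<le> \<mu> b" "x = (\<Sum>b\<in>B. \<mu> b *\<^sub>R b)" "\<forall>b\<in>B. 0 \<le> \<nu> b" "y = (\<Sum>b\<in>B. \<nu> b *\<^sub>R b)"
    using assms by (auto simp: nonneg_span_def)
  then have "(\<forall>b\<in>B. 0 \<le> \<mu> b + \<nu> b) \<and> x + y = (\<Sum>b\<in>B. (\<mu> b + \<nu> b) *\<^sub>R b)"
    by (simp add: sum.distrib scaleR_left_distrib)
  then show ?thesis
    unfolding nonneg_span_def mem_Collect_eq by (rule exI[of _ "\<lambda>b. \<mu> b + \<nu> b"])
qed

lemma nonneg_span_scale:
  assumes "x \<in> nonneg_span B" "0 \<le> c"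
  shows "c *\<^sub>R x \<in> nonneg_span B"
proof -
  obtain \<mu> where "\<forall>b\<in>B. 0 \<le> \<mu> b" "x = (\<Sum>b\<in>B. \<mu> b *\<^sub>R b)"
    using assms by (auto simp: nonneg_span_def)
  then have "(\<forall>b\<in>B. 0 \<le> c * \<mu> b) \<and> c *\<^sub>R x = (\<Sum>b\<in>B. (c * \<mu> b) *\<^sub>R b)"
    using assms(2) by (simp add: scaleR_right.sum)
  then show ?thesis
    unfolding nonneg_span_def mem_Collect_eq by (rule exI[of _ "\<lambda>b. c * \<mu> b"])
qed

lemma nonneg_span_0: "0 \<in> nonneg_span B"
  unfolding nonneg_span_def by (auto intro!: exI[of _ "\<lambda>_. 0"])

lemma nonneg_span_mono:
  assumes "finite B" "C \<subseteq> B"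
  shows "nonneg_span C \<subseteq> nonneg_span B"
proof
  fix x assume "x \<in> nonneg_span C"
  then obtain \<mu> where \<mu>: "\<forall>b\<in>C. 0 \<le> \<mu> b" "x = (\<Sum>b\<in>C. \<mu> b *\<^sub>R b)"
    by (auto simp: nonneg_span_def)
  have "(\<Sum>b\<in>B. (if b \<in> C then \<mu> b else 0) *\<^sub>R b) = (\<Sum>b\<in>C. \<mu> b *\<^sub>R b)"
    using assms by (intro sum.mono_neutral_cong_right) auto
  then have "(\<forall>b\<in>B. 0 \<le> (if b \<in> C then \<mu> b else 0)) \<and> x = (\<Sum>b\<in>B. (if b \<in> C then \<mu> b else 0) *\<^sub>R b)"
    using \<mu> by auto
  then show "x \<in> nonneg_span B"
    unfolding nonneg_span_def mem_Collect_eq by (rule exI[of _ "\<lambda>b. if b \<in> C then \<mu> b else 0"])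
qed

lemma nonneg_span_base:
  assumes "finite B" "b \<in> B"
  shows "b \<in> nonneg_span B"
proof -
  have "b \<in> nonneg_span {b}"
    unfolding nonneg_span_def by (auto intro!: exI[of _ "\<lambda>_. 1"])
  then show ?thesis
    using nonneg_span_mono[of B "{b}"] assms by auto
qed

lemma nonneg_span_sum:
  assumes "\<And>i. i \<in> I \<Longrightarrow> f i \<in> nonneg_span B"
  shows "sum f I \<in> nonneg_span B"
  using assms by (induction I rule: infinite_finite_induct) (auto intro: nonneg_span_0 nonneg_span_add)

lemma nonneg_span_subset_span: "nonneg_span B \<subseteq> span B"
  unfolding nonneg_span_def by (auto intro: span_sum span_scale span_base)

lemma nonneg_span_iff_coord:
  assumes "independent V" "x \<in> span V"
  shows "x \<in> nonneg_span V \<longleftrightarrow> (\<forall>v\<in>V. 0 \<le> coord V x v)"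
proof
  assume "x \<in> nonneg_span V"
  then show "\<forall>v\<in>V. 0 \<le> coord V x v"
    using coord_sum_basis[OF assms(1), of _ V] by (auto simp: nonneg_span_def)
next
  assume "\<forall>v\<in>V. 0 \<le> coord V x v"
  then show "x \<in> nonneg_span V"
    using coord_expand[OF assms] unfolding nonneg_span_def by (auto intro!: exI[of _ "coord V x"])
qed

section \<open>Generic points and Caratheodory's theorem for cones\<close>

lemma infinite_gt_avoid:
  fixes M :: real
  assumes "finite X"
  shows "\<exists>t>M. t \<notin> X"
proof -
  have "infinite ({M<..} - X)"
    using assms infinite_Ioi[of M] by auto
  then have "{M<..} - X \<noteq> {}"
    by (metis finite.emptyI)
  then show ?thesis by auto
qed

lemma affine_root_avoid:
  fixes t :: real
  assumes "\<alpha> \<noteq> 0 \<or> \<beta> \<noteq> 0" "t \<noteq> - \<alpha> / \<beta>"  "\<alpha> \<noteq> 0 \<or> t \<noteq> 0"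
  shows "\<alpha> + t * \<beta> \<noteq> 0"
proof
  assume *: "\<alpha> + t * \<beta> = 0"
  show False
  proof (cases "\<beta> = 0")
    case False
    then have "t = - \<alpha> / \<beta>" using * by (simp add: field_simps)
    then show ?thesis using assms by simp
  qed (use * assms in auto)
qed

text \<open>Finitely many hyperplanes cannot cover a cone unless one of them contains all
  generators. Each new functional is handled by a shift along a generator outside its kernel, of a
  length avoiding finitely many roots.\<close>

lemma nonneg_span_avoid_kernels:
  assumes "finite F" "finite C" "\<And>f. f \<in> F \<Longrightarrow> linear f \<and> (\<exists>c\<in>C. f c \<noteq> (0::real))"
  shows "\<exists>p\<in>nonneg_span C. \<forall>f\<in>F. f p \<noteq> 0"
  using assms(1,3)
proof (induction F)
  case empty
  then show ?case using nonneg_span_0 by blast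
next
  case (insert g F)
  then obtain p where p: "p \<in> nonneg_span C" "\<forall>f\<in>F. f p \<noteq> 0" by blast
  obtain c where c: "c \<in> C" "g c \<noteq> 0" using insert.prems by blast
  obtain t where t: "t > 0" "t \<notin> (\<lambda>f. - f p / f c) ` insert g F"
    using infinite_gt_avoid[of "(\<lambda>f. - f p / f c) ` insert g F" 0] insert.hyps by auto
  have "f (p + t *\<^sub>R c) \<noteq> 0" if "f \<in> insert g F" for f
  proof -
    have "f (p + t *\<^sub>R c) = f p + t * f c"
      using insert.prems[OF that] by (simp add: linear_add linear_scale)
    moreover have "f p + t * f c \<noteq> 0"
      using that p c t by (intro affine_root_avoid) auto
    ultimately show ?thesis by simp
  qed
  moreover have "p + t *\<^sub>R c \<in> nonneg_span C"
    using nonneg_span_add[OF p(1) nonneg_span_scale[OF nonneg_span_base[OF assms(2) c(1)], of t]] t by simp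
  ultimately show ?case by blast
qed

definition bases :: "'a::euclidean_space set \<Rightarrow> 'a set set" where
  "bases B = {V. V \<subseteq> B \<and> independent V \<and> span V = span B}"

lemma basesD:
  assumes "V \<in> bases B"
  shows "V \<subseteq> B" "independent V" "span V = span B" "finite V" "card V = dim B"
  using assms finiteI_independent dim_span basis_card_eq_dim[of V B] span_superset[of B]
  by (auto simp: bases_def)

lemma finite_bases: "finite B \<Longrightarrow> finite (bases B)"
  by (rule finite_subset[of _ "Pow B"]) (auto simp: bases_def)

lemma independent_extend_bases:
  assumes "independent V" "V \<subseteq> B"
  obtains W where "V \<subseteq> W" "W \<in> bases B"
proof -
  obtain W where "V \<subseteq> W" "W \<subseteq> B" "independent W" "B \<subseteq> span W"
    using maximal_independent_subset_extend[OF assms(2,1)] by blast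
  then have "W \<in> bases B"
    by (auto simp: bases_def intro: span_mono[THEN subsetD] dest: span_minimal[of B "span W"])
  then show ?thesis using that \<open>V \<subseteq> W\<close> by blast
qed

text \<open>For \<open>x\<close> in the span of \<open>B\<close>, genericity means avoiding every
  hyperplane spanned by all but one member of a basis taken from \<open>B\<close>. These finitely
  many hyperplanes contain the walls of all possible cells.\<close>

definition generic :: "'a::euclidean_space set \<Rightarrow> 'a \<Rightarrow> bool" where
  "generic B x \<longleftrightarrow> (\<forall>V\<in>bases B. \<forall>v\<in>V. coord V x v \<noteq> 0)"

text \<open>The freedom in \<open>C\<close> serves to place a generic direction inside a prescribed
  cell, or in the cone over fewer points.\<close>

lemma ex_generic:
  assumes "finite B" "C \<subseteq> B" "span C = span B"
  shows "\<exists>p\<in>nonneg_span C. generic B p"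
proof -
  define F where "F = (\<Union>V\<in>bases B. (\<lambda>v x. coord V x v) ` V)"
  have "finite F"
    unfolding F_def using finite_bases[OF assms(1)] basesD(4)[of _ B] by blast
  moreover have "finite C" using assms finite_subset by auto
  moreover have "linear f \<and> (\<exists>c\<in>C. f c \<noteq> 0)" if f: "f \<in> F" for f
  proof -
    obtain V v where V: "V \<in> bases B" "v \<in> V" "f = (\<lambda>x. coord V x v)"
      using f by (auto simp: F_def)
    note b = basesD[OF V(1)]
    have lin: "linear f" using linear_coord b V by auto
    have "\<exists>c\<in>C. f c \<noteq> 0"
    proof (rule ccontr)
      assume "\<not> ?thesis"
      then have "f v = 0"
        using linear_eq_0_on_span[OF lin, of C v] assms(3) b V span_superset by blast
      then show False using coord_basis[OF b(2) V(2)] V by simp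
    qed
    then show ?thesis using lin by blast
  qed
  ultimately obtain p where "p \<in> nonneg_span C" "\<forall>f\<in>F. f p \<noteq> 0"
    using nonneg_span_avoid_kernels[of F C] by blast
  then show ?thesis
    by (auto simp: F_def generic_def)
qed

definition pos :: "'a::euclidean_space set \<Rightarrow> 'a \<Rightarrow> bool" where
  "pos V x \<longleftrightarrow> (\<forall>v\<in>V. 0 < coord V x v)"

text \<open>Extend \<open>V\<close> to a basis \<open>W\<close>. Coordinates at \<open>W - V\<close>
  vanish on the span of \<open>V\<close>, which genericity forbids, so \<open>W = V\<close>; it also
  turns nonnegative coordinates into positive ones.\<close>

lemma generic_nonneg_span_pos:
  assumes "generic B x" "independent V" "V \<subseteq> B" "x \<in> nonneg_span V"
  shows "V \<in> bases B \<and> pos V x"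
proof -
  obtain W where W: "V \<subseteq> W" "W \<in> bases B"
    using independent_extend_bases assms by metis
  have x: "x \<in> span V" using assms nonneg_span_subset_span by blast
  have "v \<in> V" if "v \<in> W" for v
  proof -
    have "coord W x v \<noteq> 0" using assms(1) W that unfolding generic_def by blast
    then show ?thesis
      using coord_subset[OF basesD(2)[OF W(2)] W(1) x that] by presburger
  qed
  then have eq: "W = V" using W by auto
  then show ?thesis
    using W assms nonneg_span_iff_coord[OF assms(2) x]
    by (metis generic_def order_less_le pos_def)
qed

text \<open>Applying \<tau> to a linear relation shows that its coefficients sum to zero, so a
  nontrivial one has a positive coefficient. Subtracting a suitable multiple removes one generator
  and keeps the others nonnegative.\<close>

lemma nonneg_span_caratheodory:
  assumes "finite B" "x \<in> nonneg_span B" "\<And>b. b \<in> B \<Longrightarrow> \<tau> b = 1" "linear (\<tau>::_\<Rightarrow>real)"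
  shows "\<exists>V\<subseteq>B. independent V \<and> x \<in> nonneg_span V"
  using assms
proof (induction "card B" arbitrary: B rule: less_induct)
  case less
  show ?case
  proof (cases "independent B")
    case False
    obtain c v where c: "(\<Sum>b\<in>B. c b *\<^sub>R b) = 0" "v \<in> B" "c v \<noteq> 0"
      using False dependent_finite[OF less.prems(1)] by auto
    have "0 = \<tau> (\<Sum>b\<in>B. c b *\<^sub>R b)"
      using c less.prems(4) by (simp add: linear_0)
    also have "\<dots> = (\<Sum>b\<in>B. c b)"
      using less.prems(3,4) by (simp add: linear_sum linear_scale)
    finally have "(\<Sum>b\<in>B. c b) = 0" by simp
    then have "\<exists>u\<in>B. c u > 0"
      using sum_nonneg_eq_0_iff[OF less.prems(1), of "\<lambda>b. - c b"] c
      by (fastforce simp: sum_negf not_less)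
    then have ne: "{b\<in>B. c b > 0} \<noteq> {}" by auto
    obtain \<mu> where \<mu>: "\<forall>b\<in>B. 0 \<le> \<mu> b" "x = (\<Sum>b\<in>B. \<mu> b *\<^sub>R b)"
      using less.prems by (auto simp: nonneg_span_def)
    obtain u where u: "u \<in> B" "c u > 0" "\<And>b. b \<in> B \<Longrightarrow> c b > 0 \<Longrightarrow> \<mu> u / c u \<le> \<mu> b / c b"
    proof -
      define U where "U = {b\<in>B. c b > 0}"
      have U: "finite U" "U \<noteq> {}" using ne less.prems(1) by (auto simp: U_def)
      have "Min ((\<lambda>b. \<mu> b / c b) ` U) \<in> (\<lambda>b. \<mu> b / c b) ` U" using U by (intro Min_in) auto
      then obtain u where "u \<in> U" "\<mu> u / c u = Min ((\<lambda>b. \<mu> b / c b) ` U)" by auto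
      then show ?thesis using that[of u] U by (auto simp: U_def)
    qed
    \<comment> \<open>The largest multiple of the relation that leaves all coefficients nonnegative;
      the coefficient at \<open>u\<close> becomes zero.\<close>
    define t where "t = \<mu> u / c u"
    define \<nu> where "\<nu> b = \<mu> b - t * c b" for b
    have t0: "t \<ge> 0" using u \<mu> by (simp add: t_def)
    have nu: "0 \<le> \<nu> b" if "b \<in> B" for b
    proof (cases "c b > 0")
      case True
      then have "t \<le> \<mu> b / c b" using u that by (auto simp: t_def)
      then show ?thesis using True by (simp add: \<nu>_def field_simps)
    next
      case False
      then have "t * c b \<le> 0" using t0 by (simp add: mult_nonneg_nonpos)
      then show ?thesis using \<mu>(1)[rule_format, OF that] by (simp add: \<nu>_def)
    qed
    have "x = (\<Sum>b\<in>B. \<nu> b *\<^sub>R b)"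
      using \<mu> c by (simp add: \<nu>_def scaleR_left_diff_distrib sum_subtractf flip: scaleR_scaleR scaleR_right.sum)
    also have "\<dots> = (\<Sum>b\<in>B-{u}. \<nu> b *\<^sub>R b)"
      using u less.prems(1) by (intro sum.mono_neutral_right) (auto simp: \<nu>_def t_def)
    finally have "x \<in> nonneg_span (B - {u})"
      using nu unfolding nonneg_span_def by blast
    moreover have "card (B - {u}) < card B"
      using u less.prems(1) by (intro card_Diff1_less)
    ultimately show ?thesis
      using less.hyps[of "B - {u}"] less.prems by blast
  qed (use less in auto)
qed

section \<open>Iterated sumsets and lexicographic positivity\<close>

abbreviation ksum :: "nat \<Rightarrow> 'a::comm_monoid_add set \<Rightarrow> 'a set" where
  "ksum k B \<equiv> (\<Sum>i<k. B)"

lemma ksum_mono: "B \<subseteq> C \<Longrightarrow> ksum k B \<subseteq> ksum k C"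
  by (induction k) (auto intro: set_plus_mono2[THEN subsetD])

lemma finite_ksum: "finite B \<Longrightarrow> finite (ksum k B)"
  by (induction k) (auto intro: finite_set_plus)

lemma ksum_nonempty: "B \<noteq> {} \<Longrightarrow> ksum k B \<noteq> {}"
  by (induction k) (auto simp: set_plus_def)

lemma scaleR_ksum: "u \<in> V \<Longrightarrow> real k *\<^sub>R u \<in> ksum k (V :: 'a::real_vector set)"
proof (induction k)
  case (Suc k)
  then have "real k *\<^sub>R u + u \<in> ksum k V + V" by auto
  then show ?case by (simp add: algebra_simps)
qed simp

lemma ksum_nonneg_span: "finite B \<Longrightarrow> ksum k B \<subseteq> nonneg_span B"
proof (induction k)
  case (Suc k)
  have "x + y \<in> nonneg_span B" if "x \<in> ksum k B" "y \<in> B" for x y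
    using nonneg_span_add[OF _ nonneg_span_base] Suc that by blast
  then show ?case
    by (auto simp: set_plus_def)
qed (simp add: nonneg_span_0)

lemma ksum_level:
  assumes "linear \<tau>" "\<And>b. b \<in> B \<Longrightarrow> \<tau> b = (1::real)" "y \<in> ksum k B"
  shows "\<tau> y = k"
  using assms(3)
proof (induction k arbitrary: y)
  case 0
  then show ?case using assms(1) by (simp add: linear_0)
next
  case (Suc k)
  then show ?case using assms(1,2) by (auto simp: set_plus_def linear_add)
qed

lemma ksum_coord_Nats:
  assumes "independent V" "y \<in> ksum k V"
  shows "coord V y v \<in> \<nat>"
  using assms(2)
proof (induction k arbitrary: y)
  case 0
  then show ?case by (simp add: coord_linear_simps[OF assms(1)])
next
  case (Suc k)
  then show ?case
    by (auto simp: set_plus_def coord_linear_simps[OF assms(1)] coord_basis[OF assms(1)])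
qed

text \<open>In a sum of members of an independent set the coordinate at \<open>v\<close> counts the
  copies of \<open>v\<close>; if it is nonzero, one copy can be taken out.\<close>

lemma ksum_remove:
  assumes "independent V" "y \<in> ksum (Suc k) V" "v \<in> V" "coord V y v \<noteq> 0"
  shows "y - v \<in> ksum k V"
  using assms(2,4)
proof (induction k arbitrary: y)
  case 0
  then have "y \<in> V" by simp
  then show ?case using 0 coord_basis[OF assms(1), of y v] by (auto split: if_splits)
next
  case (Suc k)
  then obtain z u where z: "z \<in> ksum (Suc k) V" "u \<in> V" "y = z + u"
    using sum.lessThan_Suc[of "\<lambda>_. V" "Suc k"] by (auto simp: set_plus_def)
  show ?case
  proof (cases "u = v")
    case False
    then have "coord V z v \<noteq> 0"
      using Suc.prems(2) z coord_basis[OF assms(1) z(2), of v] by (simp add: coord_linear_simps[OF assms(1)])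
    then have "z - v \<in> ksum k V" using Suc.IH z by blast
    then have "(z - v) + u \<in> ksum k V + V" using z by (intro set_plus_intro)
    then show ?thesis using z by (simp add: algebra_simps)
  qed (use z in simp)
qed

text \<open>Either no summand is \<open>v\<close>, or one copy of \<open>v\<close> can be split off.
  For an independent set with \<open>v\<close> new, the two parts are disjoint and this becomes
  Pascal's rule.\<close>

lemma ksum_insert:
  fixes V :: "'a::ab_group_add set"
  shows "ksum (Suc k) (insert v V) = ksum (Suc k) V \<union> (+) v ` ksum k (insert v V)"
proof
  show "ksum (Suc k) (insert v V) \<subseteq> ksum (Suc k) V \<union> (+) v ` ksum k (insert v V)"
  proof (induction k)
    case (Suc k)
    show ?case
    proof
      fix y assume "y \<in> ksum (Suc (Suc k)) (insert v V)"
      then obtain z u where z: "z \<in> ksum (Suc k) (insert v V)" "u \<in> insert v V" "y = z + u"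
        using sum.lessThan_Suc[of "\<lambda>_. insert v V" "Suc k"] by (auto simp: set_plus_def)
      show "y \<in> ksum (Suc (Suc k)) V \<union> (+) v ` ksum (Suc k) (insert v V)"
      proof (cases "u = v")
        case True
        then show ?thesis using z by (auto simp: add.commute simp del: sum.lessThan_Suc)
      next
        case False
        then have u: "u \<in> V" using z by simp
        consider "z \<in> ksum (Suc k) V" | z' where "z' \<in> ksum k (insert v V)" "z = v + z'"
          using Suc z(1) by blast
        then show ?thesis
        proof cases
          case 1
          then show ?thesis using z u sum.lessThan_Suc[of "\<lambda>_. V" "Suc k"] by (auto simp del: sum.lessThan_Suc)
        next
          case 2
          then have "z' + u \<in> ksum (Suc k) (insert v V)" using z by auto
          then show ?thesis using 2 z by (auto simp: add.assoc simp del: sum.lessThan_Suc)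
        qed
      qed
    qed
  qed auto
  show "ksum (Suc k) V \<union> (+) v ` ksum k (insert v V) \<subseteq> ksum (Suc k) (insert v V)"
    using ksum_mono[of V "insert v V" "Suc k"] by (auto simp: add.commute set_plus_def simp flip: sum.lessThan_Suc) (auto simp: set_plus_def)
qed

section \<open>Cardinalities of sumsets inside one simplex\<close>

lemma card_translate_set: "card ((+) (v::'a::ab_group_add) ` S) = card S"
  by (simp add: card_image)

text \<open>The elements correspond to multisets of size \<open>k\<close>. Truncated subtraction
  gives the right value 1 when \<open>V\<close> is empty and \<open>k\<close> is 0.\<close>

lemma card_ksum:
  assumes "independent (V :: 'a::euclidean_space set)"
  shows "card (ksum k V) = (card V + k - 1) choose k"
proof -
  have "finite V" using assms finiteI_independent by blast
  then show ?thesis using assms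
  proof (induction V arbitrary: k)
    case empty
    then show ?case by (cases k) auto
  next
    case (insert v V)
    have ind: "independent V" using insert.prems independent_mono by blast
    show ?case
    proof (induction k)
      case (Suc k)
      have "coord (insert v V) y v = 0" if "y \<in> ksum (Suc k) V" for y
      proof -
        have "y \<in> span V" using ksum_nonneg_span[OF insert.hyps(1)] nonneg_span_subset_span that by blast
        then show ?thesis using coord_subset[OF insert.prems, of V y v] insert.hyps(2) by auto
      qed
      moreover have "coord (insert v V) y v \<noteq> 0" if "y \<in> (+) v ` ksum k (insert v V)" for y
      proof -
        obtain z where z: "z \<in> ksum k (insert v V)" "y = v + z" using \<open>y \<in> _\<close> by blast
        have "coord (insert v V) z v \<ge> 0" using ksum_coord_Nats[OF insert.prems z(1), of v] by (auto elim!: Nats_cases)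
        moreover have "coord (insert v V) v v = 1" using coord_basis[OF insert.prems, of v v] by simp
        ultimately show ?thesis using z by (simp add: coord_linear_simps[OF insert.prems])
      qed
      ultimately have "ksum (Suc k) V \<inter> (+) v ` ksum k (insert v V) = {}" by blast
      then have "card (ksum (Suc k) (insert v V)) = card (ksum (Suc k) V) + card (ksum k (insert v V))"
        unfolding ksum_insert using insert.hyps(1)
        by (subst card_Un_disjoint) (auto simp: card_translate_set intro!: finite_ksum finite_set_plus)
      also have "\<dots> = ((card V + k) choose Suc k) + ((card V + k) choose k)"
        using insert.IH[OF ind, of "Suc k"] Suc insert.hyps by simp
      finally show ?case using insert.hyps by simp
    qed simp
  qed
qed

text \<open>Cover the larger sumset by \<open>A + ksum k V\<close> and one translate of
  \<open>ksum k V\<close> for each missing vertex. If \<open>v\<close> is missing and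
  \<open>u\<close> is another vertex, an element using both is covered twice, which makes the bound
  strict.\<close>

lemma card_plus_ksum_ge:
  assumes "independent (V :: 'a::euclidean_space set)" "A \<subseteq> V"
  shows "card (ksum (Suc k) V) \<le> card (A + ksum k V) + card (V - A) * card (ksum k V)"
    and "\<lbrakk>A \<noteq> V; card V \<ge> 2; k \<ge> 1\<rbrakk> \<Longrightarrow>
      card (ksum (Suc k) V) < card (A + ksum k V) + card (V - A) * card (ksum k V)"
proof -
  have fin: "finite V" using assms finiteI_independent by blast
  have finA: "finite A" using fin assms finite_subset by blast
  note fk = finite_ksum[OF fin, of k]
  have fA: "finite (A + ksum k V)" using finA fk by (rule finite_set_plus)
  have union_card: "card (\<Union>w\<in>W. (+) w ` ksum k V) \<le> card W * card (ksum k V)" if "W \<subseteq> V" for W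
    using card_UN_le[OF finite_subset[OF that fin], of "\<lambda>w. (+) w ` ksum k V"] by (simp add: card_translate_set)
  have sub: "ksum (Suc k) V \<subseteq> (A + ksum k V) \<union> (\<Union>w\<in>V - A. (+) w ` ksum k V)"
  proof
    fix x assume "x \<in> ksum (Suc k) V"
    then obtain s w where "s \<in> ksum k V" "w \<in> V" "x = w + s"
      by (auto simp: set_plus_def add.commute)
    then show "x \<in> (A + ksum k V) \<union> (\<Union>w\<in>V - A. (+) w ` ksum k V)"
      by (cases "w \<in> A") (auto intro: set_plus_intro)
  qed
  have "finite ((A + ksum k V) \<union> (\<Union>w\<in>V - A. (+) w ` ksum k V))"
    by (intro finite_UnI finite_UN_I finite_imageI finite_Diff fin fA fk)
  from card_mono[OF this sub]
  have "card (ksum (Suc k) V) \<le> card ((A + ksum k V) \<union> (\<Union>w\<in>V - A. (+) w ` ksum k V))" .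
  also have "\<dots> \<le> card (A + ksum k V) + card (\<Union>w\<in>V - A. (+) w ` ksum k V)"
    by (rule card_Un_le)
  also have "\<dots> \<le> card (A + ksum k V) + card (V - A) * card (ksum k V)"
    using union_card[OF Diff_subset] by (rule add_left_mono)
  finally show "card (ksum (Suc k) V) \<le> card (A + ksum k V) + card (V - A) * card (ksum k V)" .
  assume ne: "A \<noteq> V" and V2: "card V \<ge> 2" and k: "k \<ge> 1"
  obtain v where v: "v \<in> V" "v \<notin> A" using ne assms by blast
  have "card (V - {v}) \<noteq> 0" using V2 v fin by simp
  then obtain u where u: "u \<in> V" "u \<noteq> v" using fin by (metis Diff_iff card.empty equals0I insertI1)
  obtain j where j: "k = Suc j" using k by (cases k) auto
  obtain z where z: "z \<in> ksum j V" using ksum_nonempty[of V j] v by auto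
  define y where "y = v + (z + u)"
  have y1: "z + u \<in> ksum k V" using z u by (auto simp: j)
  have y2: "y = u + (z + v)" "z + v \<in> ksum k V" using z v by (auto simp: j y_def algebra_simps)
  let ?R = "(A + ksum k V) \<union> (\<Union>w\<in>V - A - {v}. (+) w ` ksum k V)"
  have yR: "y \<in> ?R"
    using y2 u by (cases "u \<in> A") (auto intro: set_plus_intro)
  have "ksum (Suc k) V \<subseteq> ?R \<union> ((+) v ` ksum k V - {y})"
  proof
    fix x assume "x \<in> ksum (Suc k) V"
    then obtain s w where s: "s \<in> ksum k V" "w \<in> V" "x = w + s"
      by (auto simp: set_plus_def add.commute)
    show "x \<in> ?R \<union> ((+) v ` ksum k V - {y})"
    proof (cases "x = y")
      case False
      then show ?thesis using s by (cases "w \<in> A"; cases "w = v") (auto intro: set_plus_intro)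
    qed (use yR in simp)
  qed
  moreover have "finite (?R \<union> ((+) v ` ksum k V - {y}))"
    by (intro finite_UnI finite_UN_I finite_imageI finite_Diff fin fA fk)
  ultimately have "card (ksum (Suc k) V) \<le> card (?R \<union> ((+) v ` ksum k V - {y}))"
    by (rule card_mono[rotated])
  also have "\<dots> \<le> card ?R + card ((+) v ` ksum k V - {y})"
    by (rule card_Un_le)
  also have "card ?R \<le> card (A + ksum k V) + card (V - A - {v}) * card (ksum k V)"
    using card_Un_le[of "A + ksum k V" "\<Union>w\<in>V - A - {v}. (+) w ` ksum k V"] union_card[of "V - A - {v}"]
    by (meson Diff_subset add_left_mono order_trans)
  also have "card ((+) v ` ksum k V - {y}) < card ((+) v ` ksum k V)"
    using fk y1 by (intro psubset_card_mono) (auto simp: y_def)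
  also have "card (A + ksum k V) + card (V - A - {v}) * card (ksum k V) + card ((+) v ` ksum k V)
      = card (A + ksum k V) + card (V - A) * card (ksum k V)"
  proof -
    have "card (V - A) = Suc (card (V - A - {v}))"
      using v fin by (intro card.remove) auto
    then show ?thesis by (simp add: card_translate_set)
  qed
  finally show "card (ksum (Suc k) V) < card (A + ksum k V) + card (V - A) * card (ksum k V)"
    by simp
qed

text \<open>Holds iff \<open>x + \<epsilon>p\<close> has positive coordinates for all small \<open>\<epsilon> > 0\<close>.\<close>

definition lex_pos :: "'a::euclidean_space \<Rightarrow> 'a set \<Rightarrow> 'a \<Rightarrow> bool" where
  "lex_pos p V x \<longleftrightarrow> (\<forall>v\<in>V. 0 < coord V x v \<or> coord V x v = 0 \<and> 0 < coord V p v)"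

lemma eventually_perturb_pos:
  fixes \<alpha> \<beta> :: real
  assumes "\<beta> \<noteq> 0"
  shows "eventually (\<lambda>e. \<alpha> + e * \<beta> \<noteq> 0 \<and> (0 < \<alpha> + e * \<beta> \<longleftrightarrow> 0 < \<alpha> \<or> \<alpha> = 0 \<and> 0 < \<beta>)) (at_right 0)"
proof -
  have lim: "((\<lambda>e. \<alpha> + e * \<beta>) \<longlongrightarrow> \<alpha> + 0 * \<beta>) (at_right 0)"
    by (intro tendsto_intros)
  consider "\<alpha> > 0" | "\<alpha> < 0" | "\<alpha> = 0" by linarith
  then show ?thesis
  proof cases
    case 1
    then have "eventually (\<lambda>e. \<alpha> + e * \<beta> > 0) (at_right 0)"
      using order_tendstoD(1)[OF lim, of 0] by simp
    then show ?thesis by eventually_elim (use 1 in auto)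
  next
    case 2
    then have "eventually (\<lambda>e. \<alpha> + e * \<beta> < 0) (at_right 0)"
      using order_tendstoD(2)[OF lim, of 0] by simp
    then show ?thesis by eventually_elim (use 2 in auto)
  next
    case 3
    have "eventually (\<lambda>e::real. e > 0) (at_right 0)" by (simp add: eventually_at_right_less)
    then show ?thesis by eventually_elim (use 3 assms in \<open>auto simp: zero_less_mult_iff\<close>)
  qed
qed

text \<open>Only finitely many coordinates occur, so one small \<open>e\<close> serves all bases;
  genericity of \<open>p\<close> breaks every tie at a zero coordinate.\<close>

lemma eventually_perturb_generic:
  assumes "finite B" "generic B p"
  shows "eventually (\<lambda>e. generic B (x + e *\<^sub>R p) \<and> (\<forall>V\<in>bases B. pos V (x + e *\<^sub>R p) \<longleftrightarrow> lex_pos p V x)) (at_right 0)"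
proof -
  have "eventually (\<lambda>e. \<forall>V\<in>bases B. \<forall>v\<in>V. coord V (x + e *\<^sub>R p) v \<noteq> 0 \<and>
     (0 < coord V (x + e *\<^sub>R p) v \<longleftrightarrow> 0 < coord V x v \<or> coord V x v = 0 \<and> 0 < coord V p v)) (at_right 0)"
  proof (intro eventually_ball_finite ballI finite_bases assms)
    fix V assume V: "V \<in> bases B"
    then show "finite V" by (rule basesD)
    fix v assume "v \<in> V"
    then have "coord V p v \<noteq> 0" using assms V by (auto simp: generic_def)
    then show "eventually (\<lambda>e. coord V (x + e *\<^sub>R p) v \<noteq> 0 \<and>
     (0 < coord V (x + e *\<^sub>R p) v \<longleftrightarrow> 0 < coord V x v \<or> coord V x v = 0 \<and> 0 < coord V p v)) (at_right 0)"
      using eventually_perturb_pos[of "coord V p v" "coord V x v"]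
      by (simp add: coord_linear_simps[OF basesD(2)[OF V]])
  qed
  then show ?thesis
    by eventually_elim (auto simp: generic_def pos_def lex_pos_def)
qed

text \<open>A tiling of the cone over \<open>B\<close>, stated with generic points and open cones so
  that walls need no separate treatment. Regular triangulations and lifted simplicial complexes
  share this form.\<close>

definition triangulates :: "'a::euclidean_space set \<Rightarrow> 'a set set \<Rightarrow> bool" where
  "triangulates B T \<longleftrightarrow> T \<subseteq> bases B \<and>
     (\<forall>x\<in>nonneg_span B. generic B x \<longrightarrow> (\<exists>V\<in>T. pos V x)) \<and>
     (\<forall>V\<in>T. \<forall>W\<in>T. \<forall>x\<in>span B. pos V x \<and> pos W x \<longrightarrow> V = W)"

definition critical_size :: "nat \<Rightarrow> nat \<Rightarrow> nat \<Rightarrow> int" where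
  "critical_size q k N = int ((q + k) choose k) * int N - int k * int ((q + k) choose (k + 1))"

text \<open>By absorption the difference reduces to the two terms of Pascal's rule. The value is the
  size of the sumset when \<open>A\<close> and \<open>B\<close> are both the vertex set of a
  \<open>q\<close>-simplex, so such pairs are critical.\<close>

lemma critical_size_simplex: "critical_size q k (Suc q) = int ((q + Suc k) choose Suc k)"
proof -
  have "Suc k * ((q + k) choose Suc k) = q * ((q + k) choose k)"
    using binomial_absorption[of k "q + k"] binomial_absorb_comp[of "q + k" k] by simp
  then have "int (Suc k * ((q + k) choose Suc k)) = int (q * ((q + k) choose k))" by (simp only:)
  then show ?thesis
    by (simp add: critical_size_def algebra_simps)
qed

section \<open>Half-open decompositions\<close>

locale half_open =
  fixes \<tau> :: "'a::euclidean_space \<Rightarrow> real" and B :: "'a set" and T :: "'a set set" and p :: 'a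
  assumes linear_level: "linear \<tau>"
    and finite_B: "finite B"
    and level_B: "b \<in> B \<Longrightarrow> \<tau> b = 1"
    and triang: "triangulates B T"
    and p_nonneg: "p \<in> nonneg_span B"
    and p_generic: "generic B p"
begin

lemma T_bases: "V \<in> T \<Longrightarrow> V \<in> bases B"
  using triang by (auto simp: triangulates_def)

lemmas TD = basesD[OF T_bases]

lemma in_span: "x \<in> nonneg_span B \<Longrightarrow> x \<in> span B"
  using nonneg_span_subset_span by blast

text \<open>Lexicographic positivity at \<open>x\<close> is ordinary positivity at a point slightly
  displaced along \<open>p\<close>, and open cones of the tiling are disjoint.\<close>

lemma lex_pos_unique:
  assumes "V \<in> T" "W \<in> T" "x \<in> span B" "lex_pos p V x" "lex_pos p W x"
  shows "V = W"
proof -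
  obtain e where "\<forall>V\<in>bases B. pos V (x + e *\<^sub>R p) \<longleftrightarrow> lex_pos p V x"
    using eventually_happens'[OF trivial_limit_at_right_real eventually_perturb_generic[OF finite_B p_generic, of x]] by blast
  then have "pos V (x + e *\<^sub>R p)" "pos W (x + e *\<^sub>R p)"
    using assms T_bases by blast+
  moreover have "x + e *\<^sub>R p \<in> span B"
    using assms p_nonneg in_span by (intro span_add span_scale) auto
  ultimately show ?thesis
    using triang assms(1,2) unfolding triangulates_def by blast
qed

lemma ex_lex_pos:
  assumes "x \<in> nonneg_span B"
  shows "\<exists>V\<in>T. lex_pos p V x"
proof -
  have "eventually (\<lambda>e. e > 0 \<and> generic B (x + e *\<^sub>R p) \<and> (\<forall>V\<in>bases B. pos V (x + e *\<^sub>R p) \<longleftrightarrow> lex_pos p V x)) (at_right 0)"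
    using eventually_conj[OF eventually_at_right_less eventually_perturb_generic[OF finite_B p_generic, of x]] by simp
  then obtain e where e: "e > 0" "generic B (x + e *\<^sub>R p)" "\<forall>V\<in>bases B. pos V (x + e *\<^sub>R p) \<longleftrightarrow> lex_pos p V x"
    using eventually_happens'[OF trivial_limit_at_right_real] by blast
  moreover have "x + e *\<^sub>R p \<in> nonneg_span B"
    using assms e p_nonneg nonneg_span_add nonneg_span_scale less_imp_le by metis
  ultimately obtain V where "V \<in> T" "pos V (x + e *\<^sub>R p)"
    using triang unfolding triangulates_def by blast
  then show ?thesis using e T_bases by blast
qed

definition cell :: "'a \<Rightarrow> 'a set" where
  "cell x = (THE V. V \<in> T \<and> lex_pos p V x)"

lemma cellI:
  assumes "V \<in> T" "x \<in> span B" "lex_pos p V x"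
  shows "cell x = V"
  unfolding cell_def using assms lex_pos_unique by (intro the_equality) auto

lemma cell:
  assumes "x \<in> nonneg_span B"
  shows "cell x \<in> T" "lex_pos p (cell x) x"
  using ex_lex_pos[OF assms] cellI in_span[OF assms] by auto

lemma lex_pos_nonneg_span:
  assumes "V \<in> T" "x \<in> span B" "lex_pos p V x"
  shows "x \<in> nonneg_span V"
  using assms TD[OF assms(1)] nonneg_span_iff_coord[of V x] by (force simp: lex_pos_def)

lemma cell_nonneg_span: "x \<in> nonneg_span B \<Longrightarrow> x \<in> nonneg_span (cell x)"
  using lex_pos_nonneg_span cell in_span by blast

lemma nonneg_span_T: "V \<in> T \<Longrightarrow> nonneg_span V \<subseteq> nonneg_span B"
  using nonneg_span_mono finite_B TD(1) by blast

text \<open>Adding a vector of the cone over the cell lowers no coordinate: positive ones stay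
  positive, and a tie at zero persists or is resolved upwards.\<close>

lemma cell_add:
  assumes "a \<in> nonneg_span B" "y \<in> nonneg_span (cell a)"
  shows "cell (a + y) = cell a"
proof (rule cellI)
  note V = cell(1)[OF assms(1)]
  show "cell a \<in> T" by (rule V)
  have y: "y \<in> span B" using assms(2) nonneg_span_subset_span TD(3)[OF V] by blast
  then show "a + y \<in> span B" using in_span[OF assms(1)] by (rule span_add[rotated])
  have "0 \<le> coord (cell a) y v" if "v \<in> cell a" for v
    using assms(2) nonneg_span_iff_coord[OF TD(2)[OF V]] y TD(3)[OF V] that by auto
  then show "lex_pos p (cell a) (a + y)"
    using cell(2)[OF assms(1)] unfolding lex_pos_def coord_linear_simps[OF TD(2)[OF V]]
    by (smt (verit, best))
qed

lemma level_coord: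
  assumes "V \<in> T" "x \<in> span B"
  shows "(\<Sum>v\<in>V. coord V x v) = \<tau> x"
proof -
  have "\<tau> x = \<tau> (\<Sum>v\<in>V. coord V x v *\<^sub>R v)"
    using coord_expand[of V x] TD[OF assms(1)] assms by simp
  also have "\<dots> = (\<Sum>v\<in>V. coord V x v)"
    using level_B TD(1)[OF assms(1)] by (auto simp: linear_sum[OF linear_level] linear_scale[OF linear_level] intro!: sum.cong)
  finally show ?thesis by simp
qed

lemma level1_coord_le:
  assumes "V \<in> T" "x \<in> nonneg_span V" "\<tau> x = 1" "v \<in> V"
  shows "coord V x v \<le> 1"
proof -
  have x: "x \<in> span V" using assms nonneg_span_subset_span by blast
  have "coord V x v \<le> (\<Sum>v\<in>V. coord V x v)"
    using assms TD[OF assms(1)] nonneg_span_iff_coord[OF TD(2) x] by (intro member_le_sum) auto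
  then show ?thesis using level_coord[OF assms(1), of x] x TD[OF assms(1)] assms by simp
qed

lemma level1_coord_eq_1:
  assumes "V \<in> T" "x \<in> nonneg_span V" "\<tau> x = 1" "v \<in> V" "coord V x v = 1"
  shows "x = v"
proof (rule coord_inject)
  note V = TD[OF assms(1)]
  show ind: "independent V" and "v \<in> span V" and x: "x \<in> span V"
    using V(2) subsetD[OF nonneg_span_subset_span assms(2)] span_base[OF assms(4)] by auto
  have "(\<Sum>u\<in>V - {v}. coord V x u) = 0"
    using level_coord[OF assms(1), of x] x V assms sum.remove[OF V(4) assms(4), of "coord V x"] by simp
  moreover have "\<And>u. u \<in> V - {v} \<Longrightarrow> 0 \<le> coord V x u"
    using nonneg_span_iff_coord[OF ind x] assms(2) by blast
  ultimately have "\<forall>u\<in>V - {v}. coord V x u = 0"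
    using sum_nonneg_eq_0_iff[of "V - {v}" "coord V x"] V(4) by blast
  then show "coord V x u = coord V v u" if "u \<in> V" for u
    using coord_basis[OF ind assms(4), of u] assms(5) that by (cases "u = v") auto
qed

text \<open>Both coordinate vectors sum to 1, so if they differ, some coordinate of \<open>a\<close>
  is larger, and by integrality larger by at least 1. It therefore equals 1, and \<open>a\<close> is
  that vertex.\<close>

lemma level1_differ_Ints:
  assumes "V \<in> T" "a \<in> nonneg_span V" "a' \<in> nonneg_span V" "\<tau> a = 1" "\<tau> a' = 1"
    and "\<And>v. v \<in> V \<Longrightarrow> coord V a v - coord V a' v \<in> \<int>" and "a \<noteq> a'"
  shows "a \<in> V"
proof -
  note V = TD[OF assms(1)]
  have sp: "a \<in> span V" "a' \<in> span V" using assms nonneg_span_subset_span by auto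
  have nn: "0 \<le> coord V a v" "0 \<le> coord V a' v" "coord V a v \<le> 1" "coord V a' v \<le> 1" if "v \<in> V" for v
    using nonneg_span_iff_coord[OF V(2)] sp assms level1_coord_le that by auto
  have "\<exists>v\<in>V. coord V a v > coord V a' v"
  proof (rule ccontr)
    assume "\<not> ?thesis"
    then have le: "coord V a v \<le> coord V a' v" if "v \<in> V" for v using that by force
    have "(\<Sum>v\<in>V. coord V a' v - coord V a v) = 0"
      using level_coord[OF assms(1)] sp V(3) assms by (simp add: sum_subtractf)
    then have "\<forall>v\<in>V. coord V a' v - coord V a v = 0"
      using sum_nonneg_eq_0_iff[of V "\<lambda>v. coord V a' v - coord V a v"] V(4) le by simp
    then show False using coord_inject[OF V(2) sp] assms by simp
  qed
  then obtain v where v: "v \<in> V" "coord V a v > coord V a' v" by blast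
  obtain z where z: "coord V a v - coord V a' v = of_int z"
    using assms(6)[OF v(1)] by (auto elim: Ints_cases)
  then have "of_int z > (0::real)" using v by linarith
  then have "z \<ge> 1" by simp
  then have "coord V a v - coord V a' v \<ge> 1" using z by simp
  then have "coord V a v = 1" using nn[OF v(1)] by linarith
  then show ?thesis using level1_coord_eq_1 assms v by blast
qed

text \<open>Membership of \<open>u\<close> in the half-open cell makes \<open>p\<close> positive at
  all other vertices, and \<open>v\<close> supplies positivity at \<open>u\<close>. So
  \<open>p\<close> is in the open cone over \<open>V\<close>, which is what having \<open>V\<close>
  as the cell of 0 means.\<close>

lemma cell_0_eq:
  assumes "V \<in> T" "u \<in> V" "v \<in> V" "u \<noteq> v" "lex_pos p V u" "lex_pos p V v"
  shows "cell 0 = V"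
proof (rule cellI)
  note V = TD[OF assms(1)]
  have "0 < coord V p w" if "w \<in> V" for w
    using assms coord_basis[OF V(2)] that unfolding lex_pos_def by (cases "w = u") force+
  then show "lex_pos p V 0" by (simp add: lex_pos_def coord_linear_simps[OF V(2)])
qed (use assms span_0 in auto)

lemma cell_0: "cell 0 \<in> T" "v \<in> cell 0 \<Longrightarrow> 0 < coord (cell 0) p v"
  using cell[OF nonneg_span_0] TD[OF cell(1)[OF nonneg_span_0]]
  by (auto simp: lex_pos_def coord_linear_simps)

lemma cell_vertex_0:
  assumes "v \<in> cell 0"
  shows "cell v = cell 0"
proof (rule cellI)
  show "lex_pos p (cell 0) v"
    using assms cell_0 coord_basis[OF TD(2)[OF cell_0(1)] assms] by (auto simp: lex_pos_def)
  show "v \<in> span B" using assms TD[OF cell_0(1)] span_base by blast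
qed (rule cell_0)

text \<open>Adding members of a cell does not leave it, so a common sum forces the cells to agree.
  The base points are then congruent modulo integer combinations of this cell, hence both vertices
  of it, and two vertices sharing a half-open cell put it at 0.\<close>

lemma cells_disjoint:
  assumes "a \<in> nonneg_span B" "a' \<in> nonneg_span B" "\<tau> a = 1" "\<tau> a' = 1"
    and "y \<in> ksum k (cell a)" "y' \<in> ksum k (cell a')" "a + y = a' + y'" "a \<noteq> a'"
  shows "a \<in> cell 0 \<and> a' \<in> cell 0"
proof -
  define V where "V = cell a"
  have VT: "V \<in> T" "cell a' \<in> T" using cell assms by (auto simp: V_def)
  note V = TD[OF VT(1)]
  have "cell (a + y) = cell a" "cell (a' + y') = cell a'"
    using cell_add[OF assms(1)] cell_add[OF assms(2)] ksum_nonneg_span[OF TD(4)[OF VT(1)], of k]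
      ksum_nonneg_span[OF TD(4)[OF VT(2)], of k] assms(5,6) V_def by blast+
  then have V': "cell a' = V" using assms V_def by simp
  have nn: "a \<in> nonneg_span V" "a' \<in> nonneg_span V"
    using cell_nonneg_span assms V' V_def by metis+
  have "coord V a v - coord V a' v \<in> \<int>" for v
  proof -
    have "coord V (a + y) v = coord V (a' + y') v" using assms by simp
    then have "coord V a v - coord V a' v = coord V y' v - coord V y v"
      by (simp add: coord_linear_simps[OF V(2)] algebra_simps)
    also have "\<dots> \<in> \<int>"
      using ksum_coord_Nats[OF V(2), of y k v] ksum_coord_Nats[OF V(2), of y' k v] assms(5,6) Nats_subset_Ints V' V_def
      by (intro Ints_diff) auto
    finally show ?thesis .
  qed
  note diff = this
  have diff': "coord V a' v - coord V a v \<in> \<int>" for v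
    using Ints_minus[OF diff[of v]] by simp
  have mem: "a \<in> V" "a' \<in> V"
    using level1_differ_Ints[OF VT(1) nn assms(3,4) diff] level1_differ_Ints[OF VT(1) nn(2,1) assms(4,3) diff'] assms(8)
    by blast+
  have "lex_pos p V a" "lex_pos p V a'" using cell(2) assms V' V_def by metis+
  then have "cell 0 = V" using cell_0_eq[OF VT(1) mem] assms by blast
  then show ?thesis using mem by simp
qed

section \<open>Counting the translates of the half-open decomposition\<close>

definition cell_sum :: "nat \<Rightarrow> 'a set \<Rightarrow> 'a set" where
  "cell_sum k A = (\<Union>a\<in>A. (+) a ` ksum k (cell a))"

lemma cell_sum_subset:
  assumes "A \<subseteq> nonneg_span B"
  shows "cell_sum k A \<subseteq> A + ksum k B"
proof
  fix x assume "x \<in> cell_sum k A"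
  then obtain a y where a: "a \<in> A" "y \<in> ksum k (cell a)" "x = a + y" by (auto simp: cell_sum_def)
  then have "y \<in> ksum k B" using ksum_mono[of "cell a" B k] TD(1)[OF cell(1)] assms by blast
  then show "x \<in> A + ksum k B" using a by auto
qed

lemma card_ksum_T: "V \<in> T \<Longrightarrow> card (ksum k V) = (dim B + k - 1) choose k"
  using card_ksum TD by metis

text \<open>Base points outside \<open>cell 0\<close> contribute disjoint translates of equal size.
  Those in \<open>cell 0\<close> all have that cell, so their overlapping translates are counted
  together as one sumset.\<close>

lemma card_cell_sum:
  assumes "finite A" "A \<subseteq> nonneg_span B" "\<And>a. a \<in> A \<Longrightarrow> \<tau> a = 1"
  shows "card (cell_sum k A) =
    card (A - cell 0) * ((dim B + k - 1) choose k) + card ((A \<inter> cell 0) + ksum k (cell 0))"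
proof -
  define S where "S a = (+) a ` ksum k (cell a)" for a
  have fin: "finite (S a)" if "a \<in> A" for a
    unfolding S_def using finite_ksum TD(4) cell(1) assms that by blast
  have dj: "S a \<inter> S a' = {}" if "a \<in> A - cell 0" "a' \<in> A" "a \<noteq> a'" for a a'
  proof (rule ccontr)
    assume "S a \<inter> S a' \<noteq> {}"
    then obtain y y' where "y \<in> ksum k (cell a)" "y' \<in> ksum k (cell a')" "a + y = a' + y'"
      unfolding S_def by blast
    then show False using cells_disjoint[of a a' y k y'] that assms by blast
  qed
  have eq: "(\<Union>a\<in>A \<inter> cell 0. S a) = (A \<inter> cell 0) + ksum k (cell 0)"
    using cell_vertex_0 by (auto simp: S_def set_plus_def image_def)
  have "cell_sum k A = (\<Union>a\<in>A - cell 0. S a) \<union> (\<Union>a\<in>A \<inter> cell 0. S a)"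
    by (auto simp: cell_sum_def S_def)
  also have "card \<dots> = card (\<Union>a\<in>A - cell 0. S a) + card (\<Union>a\<in>A \<inter> cell 0. S a)"
  proof (rule card_Un_disjoint)
    show "\<Union> (S ` (A - cell 0)) \<inter> \<Union> (S ` (A \<inter> cell 0)) = {}"
      using dj by blast
  qed (use fin assms(1) in auto)
  also have "card (\<Union>a\<in>A - cell 0. S a) = (\<Sum>a\<in>A - cell 0. card (S a))"
    using fin assms(1) dj by (intro card_UN_disjoint) auto
  also have "\<dots> = (\<Sum>a\<in>A - cell 0. (dim B + k - 1) choose k)"
    using card_ksum_T cell(1) assms(2) by (intro sum.cong) (auto simp: S_def card_translate_set)
  finally show ?thesis by (simp add: eq)
qed

context
  assumes B_nonempty: "B \<noteq> {}"
begin

lemma dim_B: "dim B = Suc (dim B - 1)"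
proof -
  obtain b where "b \<in> B" using B_nonempty by blast
  then have "b \<noteq> 0" using level_B[of b] linear_0[OF linear_level] by auto
  then have "dim B \<noteq> 0" using \<open>b \<in> B\<close> by auto
  then show ?thesis by linarith
qed

text \<open>The bracket isolates the excess over the critical size. It depends only on the cell
  containing \<open>p\<close>; it is nonnegative by \<open>card_plus_ksum_ge\<close> and zero when
  that cell lies in \<open>A\<close>.\<close>

lemma card_cell_sum_aux:
  assumes "finite A" "A \<subseteq> nonneg_span B" "\<And>a. a \<in> A \<Longrightarrow> \<tau> a = 1"
  shows "int (card (cell_sum k A)) = critical_size (dim B - 1) k (card A)
    + (int (card ((A \<inter> cell 0) + ksum k (cell 0))) + int (card (cell 0 - A)) * int (card (ksum k (cell 0)))
       - int (card (ksum (Suc k) (cell 0))))"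
proof -
  note V = TD[OF cell_0(1)]
  define q where "q = dim B - 1"
  define N where "N = (q + k) choose k"
  have q: "dim B = Suc q" using dim_B q_def by simp
  have c1: "card (ksum k (cell 0)) = N"
    using card_ksum_T[OF cell_0(1), of k] q by (simp add: N_def)
  have c2: "int (card (ksum (Suc k) (cell 0))) = critical_size q k (Suc q)"
    using card_ksum_T[OF cell_0(1), of "Suc k"] q critical_size_simplex[of q k] by simp
  have a: "card A = card (A - cell 0) + card (A \<inter> cell 0)"
    using assms(1) by (metis Int_Diff_disjoint Int_Diff_Un add.commute card_Un_disjoint finite_Diff finite_Int)
  have v: "Suc q = card (cell 0 - A) + card (A \<inter> cell 0)"
    using V(4,5) q by (metis Int_Diff_disjoint Int_Diff_Un Int_commute add.commute card_Un_disjoint finite_Diff finite_Int)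
  \<comment> \<open>The critical size is affine in the number of points, so the points common to
    \<open>A\<close> and \<open>cell 0\<close> cancel.\<close>
  have "critical_size q k (card A) - critical_size q k (Suc q) = int N * (int (card (A - cell 0)) - int (card (cell 0 - A)))"
    unfolding a v by (simp add: critical_size_def N_def algebra_simps)
  then show ?thesis
    using card_cell_sum[OF assms, of k] unfolding c2 c1 q_def[symmetric]
    using q by (simp add: N_def algebra_simps)
qed

lemma card_cell_sum_ge:
  assumes "finite A" "A \<subseteq> nonneg_span B" "\<And>a. a \<in> A \<Longrightarrow> \<tau> a = 1"
  shows "critical_size (dim B - 1) k (card A) \<le> int (card (cell_sum k A))"
proof -
  have "A \<inter> cell 0 \<subseteq> cell 0" "cell 0 - A \<inter> cell 0 = cell 0 - A" by auto
  then have "card (ksum (Suc k) (cell 0)) \<le> card (A \<inter> cell 0 + ksum k (cell 0)) + card (cell 0 - A) * card (ksum k (cell 0))"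
    using card_plus_ksum_ge(1)[OF TD(2)[OF cell_0(1)], of "A \<inter> cell 0" k] by presburger
  then show ?thesis
    using card_cell_sum_aux[OF assms, of k] by (simp flip: of_nat_add of_nat_mult)
qed

lemma card_cell_sum_eq:
  assumes "finite A" "A \<subseteq> nonneg_span B" "\<And>a. a \<in> A \<Longrightarrow> \<tau> a = 1" "cell 0 \<subseteq> A"
  shows "int (card (cell_sum k A)) = critical_size (dim B - 1) k (card A)"
proof -
  have "A \<inter> cell 0 = cell 0" and 0: "cell 0 - A = {}" using assms(4) by auto
  then show ?thesis
    using card_cell_sum_aux[OF assms(1-3), of k] unfolding 0 by (simp add: add.commute)
qed

lemma card_cell_sum_gt:
  assumes "finite A" "A \<subseteq> nonneg_span B" "\<And>a. a \<in> A \<Longrightarrow> \<tau> a = 1"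
    and "\<not> cell 0 \<subseteq> A" "dim B \<ge> 2" "k \<ge> 1"
  shows "critical_size (dim B - 1) k (card A) < int (card (cell_sum k A))"
proof -
  have "A \<inter> cell 0 \<subseteq> cell 0" "cell 0 - A \<inter> cell 0 = cell 0 - A" "A \<inter> cell 0 \<noteq> cell 0" using assms(4) by auto
  then have "card (ksum (Suc k) (cell 0)) < card (A \<inter> cell 0 + ksum k (cell 0)) + card (cell 0 - A) * card (ksum k (cell 0))"
    using card_plus_ksum_ge(2)[OF TD(2)[OF cell_0(1)], of "A \<inter> cell 0" k] assms TD(5)[OF cell_0(1)] by simp
  then have "int (card (ksum (Suc k) (cell 0))) < int (card (A \<inter> cell 0 + ksum k (cell 0))) + int (card (cell 0 - A)) * int (card (ksum k (cell 0)))"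
    by (metis of_nat_add of_nat_less_iff of_nat_mult)
  then show ?thesis
    using card_cell_sum_aux[OF assms(1-3), of k] by linarith
qed

end

end

section \<open>Regular triangulations\<close>

definition interpolate :: "'a::euclidean_space set \<Rightarrow> ('a \<Rightarrow> real) \<Rightarrow> 'a \<Rightarrow> real" where
  "interpolate V w x = (\<Sum>v\<in>V. coord V x v * w v)"

lemma linear_interpolate:
  assumes "independent V"
  shows "linear (interpolate V w)"
  by (rule linearI)
    (simp_all add: interpolate_def coord_linear_simps[OF assms] algebra_simps sum.distrib sum_distrib_left)

lemma interpolate_basis:
  assumes "independent V" "v \<in> V"
  shows "interpolate V w v = w v"
proof -
  have "finite V" using assms finiteI_independent by blast
  have "interpolate V w v = (\<Sum>u\<in>V. if u = v then w u else 0)"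
    unfolding interpolate_def using assms by (intro sum.cong) (auto simp: coord_basis)
  then show ?thesis using assms \<open>finite V\<close> by simp
qed

lemma interpolate_sum_basis:
  assumes "independent V"
  shows "interpolate V w (\<Sum>v\<in>V. c v *\<^sub>R v) = (\<Sum>v\<in>V. c v * w v)"
  using interpolate_basis[OF assms]
  by (simp add: linear_sum[OF linear_interpolate[OF assms]] linear_scale[OF linear_interpolate[OF assms]])

lemma interpolate_cong: "(\<And>v. v \<in> V \<Longrightarrow> w v = w' v) \<Longrightarrow> interpolate V w x = interpolate V w' x"
  by (simp add: interpolate_def)

text \<open>General position of the lifted points: comparing a point with the interpolated height
  over a cell never ends in a tie.\<close>

definition generic_weight :: "'a::euclidean_space set \<Rightarrow> ('a \<Rightarrow> real) \<Rightarrow> bool" where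
  "generic_weight B w \<longleftrightarrow>
     (\<forall>F\<subseteq>B. independent F \<longrightarrow> (\<forall>c\<in>B. c \<in> span F \<longrightarrow> c \<notin> F \<longrightarrow> interpolate F w c \<noteq> w c))"

lemma generic_weight_subset: "generic_weight B w \<Longrightarrow> C \<subseteq> B \<Longrightarrow> generic_weight C w"
  unfolding generic_weight_def by blast

text \<open>Each condition involving \<open>b\<close> is a linear equation in its height
  \<open>t\<close>. \<open>X1\<close> collects the bad values when \<open>b\<close> is the tested
  point, \<open>X2\<close> those when \<open>b\<close> is in \<open>F\<close> with nonzero
  coefficient; with coefficient zero the condition falls back on the old weights.\<close>

lemma generic_weight_extend:
  assumes "finite B" "generic_weight B w" "b \<notin> B"
  shows "\<exists>X. finite X \<and> (\<forall>t. t \<notin> X \<longrightarrow> generic_weight (insert b B) (w(b := t)))"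
proof -
  define X1 where "X1 = (\<lambda>F. interpolate F w b) ` Pow B"
  define X2 where "X2 = (\<lambda>(F, c). (w c - (\<Sum>f\<in>F - {b}. coord F c f * w f)) / coord F c b) ` (Pow (insert b B) \<times> B)"
  have "finite (X1 \<union> X2)"
    using assms(1) by (auto simp: X1_def X2_def)
  moreover have "generic_weight (insert b B) (w(b := t))" if t: "t \<notin> X1 \<union> X2" for t
    unfolding generic_weight_def
  proof (intro allI impI ballI)
    fix F c
    assume F: "F \<subseteq> insert b B" "independent F" and c: "c \<in> insert b B" "c \<in> span F" "c \<notin> F"
    show "interpolate F (w(b := t)) c \<noteq> (w(b := t)) c"
    proof (cases "b \<in> F")
      case False
      then have FB: "F \<subseteq> B" using F by auto
      have eq: "interpolate F (w(b := t)) c = interpolate F w c"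
        using False by (intro interpolate_cong) auto
      show ?thesis
      proof (cases "c = b")
        case True
        then show ?thesis using t FB eq by (auto simp: X1_def)
      next
        case False
        then show ?thesis using assms(2) FB F c eq by (auto simp: generic_weight_def)
      qed
    next
      case True
      then have cb: "c \<noteq> b" "c \<in> B" using c by auto
      have finF: "finite F" using F finiteI_independent by blast
      have eq: "interpolate F (w(b := t)) c = coord F c b * t + (\<Sum>f\<in>F - {b}. coord F c f * w f)"
        unfolding interpolate_def sum.remove[OF finF True] by (auto intro!: sum.cong)
      show ?thesis
      proof (cases "coord F c b = 0")
        case False
        have "t \<noteq> (w c - (\<Sum>f\<in>F - {b}. coord F c f * w f)) / coord F c b"
          using t F(1) cb(2) by (auto simp: X2_def image_iff)
        then show ?thesis using False cb unfolding eq by (auto simp: field_simps)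
      next
        case zero: True
        have sp: "c \<in> span (F - {b})"
          using coord_eq_0_span[OF F(2) c(2), of "F - {b}"] zero by auto
        have "coord F c f = coord (F - {b}) c f" if "f \<in> F - {b}" for f
          using coord_subset[OF F(2) _ sp, of f] that by auto
        then have "interpolate F (w(b := t)) c = interpolate (F - {b}) w c"
          unfolding eq zero by (simp add: interpolate_def)
        moreover have "independent (F - {b})" "F - {b} \<subseteq> B"
          using F independent_mono[OF F(2), of "F - {b}"] by auto
        ultimately show ?thesis
          using assms(2)[unfolded generic_weight_def, rule_format, of "F - {b}" c] sp cb c by auto
      qed
    qed
  qed
  ultimately show ?thesis by blast
qed

lemma ex_generic_weight:
  assumes "finite B"
  shows "\<exists>w. generic_weight B w"
  using assms
proof (induction B)
  case empty
  then show ?case by (auto simp: generic_weight_def)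
next
  case (insert b B)
  then obtain w X where "finite X" "\<forall>t. t \<notin> X \<longrightarrow> generic_weight (insert b B) (w(b := t))"
    using generic_weight_extend by metis
  then show ?case using infinite_gt_avoid by metis
qed

text \<open>A point above all interpolations by the others never obstructs a cell, so lower facets
  of \<open>B - {b}\<close> stay lower facets of \<open>B\<close> if the spans agree.\<close>

lemma ex_generic_weight_high:
  assumes "finite B" "b \<in> B"
  shows "\<exists>w. generic_weight B w \<and> (\<forall>V\<subseteq>B - {b}. interpolate V w b < w b)"
proof -
  obtain w where "generic_weight (B - {b}) w" using ex_generic_weight[of "B - {b}"] assms by auto
  then obtain X where X: "finite X" "\<forall>t. t \<notin> X \<longrightarrow> generic_weight (insert b (B - {b})) (w(b := t))"
    using generic_weight_extend[of "B - {b}" w b] assms by auto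
  let ?M = "Max ((\<lambda>V. interpolate V w b) ` Pow (B - {b}))"
  obtain t where t: "t > ?M" "t \<notin> X" using infinite_gt_avoid[OF X(1)] by blast
  have "interpolate V (w(b := t)) b < (w(b := t)) b" if V: "V \<subseteq> B - {b}" for V
  proof -
    have "interpolate V (w(b := t)) b = interpolate V w b"
      using V by (intro interpolate_cong) auto
    also have "\<dots> \<le> ?M" using V assms(1) by (intro Max_ge) auto
    finally show ?thesis using t by simp
  qed
  then show ?thesis using X(2) t(2) assms(2) by (auto simp: insert_absorb)
qed

text \<open>Negate the weights of the previous lemma. A point below all interpolations by the others
  must belong to every lower facet.\<close>

lemma ex_generic_weight_low:
  assumes "finite B" "b \<in> B"
  shows "\<exists>w. generic_weight B w \<and> (\<forall>V\<subseteq>B - {b}. interpolate V w b > w b)"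
proof -
  obtain w where w: "generic_weight B w" "\<forall>V\<subseteq>B - {b}. interpolate V w b < w b"
    using ex_generic_weight_high[OF assms] by blast
  have neg: "interpolate V (\<lambda>v. - w v) x = - interpolate V w x" for V x
    by (simp add: interpolate_def sum_negf)
  have "generic_weight B (\<lambda>v. - w v)" "\<forall>V\<subseteq>B - {b}. interpolate V (\<lambda>v. - w v) b > - w b"
    using w by (simp_all add: generic_weight_def neg)
  then show ?thesis by (intro exI[of _ "\<lambda>v. - w v"]) simp
qed

text \<open>The lower facets of the point configuration lifted by the heights \<open>w\<close>.\<close>

definition regular_triangulation :: "'a::euclidean_space set \<Rightarrow> ('a \<Rightarrow> real) \<Rightarrow> 'a set set" where
  "regular_triangulation B w = {V \<in> bases B. \<forall>b\<in>B - V. interpolate V w b < w b}"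

text \<open>A pivot of the simplex method: \<open>b\<close> enters the basis and the vertex
  \<open>u\<close> of least ratio leaves it. As \<open>b\<close> lies below the interpolated height
  over \<open>V\<close>, the height at \<open>x\<close> drops strictly; genericity makes the new
  coordinates positive.\<close>

lemma pivot:
  assumes "finite B" "V \<in> bases B" "x \<in> span B" "pos V x" "generic B x"
    and "b \<in> B" "b \<notin> V" "w b < interpolate V w b"
    and "linear \<tau>" "\<And>b. b \<in> B \<Longrightarrow> \<tau> b = (1::real)"
  shows "\<exists>W\<in>bases B. pos W x \<and> interpolate W w x < interpolate V w x"
proof -
  note V = basesD[OF assms(2)]
  define \<beta> where "\<beta> = coord V b"
  define c where "c = coord V x"
  have b: "(\<Sum>v\<in>V. \<beta> v *\<^sub>R v) = b" unfolding \<beta>_def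
    using coord_expand[OF V(2)] V(3) assms(6) span_base by blast
  have x: "(\<Sum>v\<in>V. c v *\<^sub>R v) = x" unfolding c_def
    using coord_expand[OF V(2)] V(3) assms(3) by blast
  \<comment> \<open>Since \<tau> is 1 on \<open>B\<close>, the coordinates of \<open>b\<close> sum
    to 1, so one of them is positive and some vertex can leave the basis.\<close>
  have "(\<Sum>v\<in>V. \<beta> v) = (\<Sum>v\<in>V. \<beta> v * \<tau> v)"
    using assms(10) V(1) by (intro sum.cong) auto
  also have "\<dots> = \<tau> b"
    unfolding b[symmetric] by (simp add: linear_sum[OF assms(9)] linear_scale[OF assms(9)])
  finally have "(\<Sum>v\<in>V. \<beta> v) > 0" using assms(10)[OF assms(6)] by simp
  then have "\<exists>v\<in>V. \<beta> v > 0" using sum_nonpos[of V \<beta>] by (meson not_less)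
  define U where "U = {v\<in>V. \<beta> v > 0}"
  have U: "finite U" "U \<noteq> {}" using \<open>\<exists>v\<in>V. \<beta> v > 0\<close> V(4) by (auto simp: U_def)
  have "Min ((\<lambda>v. c v / \<beta> v) ` U) \<in> (\<lambda>v. c v / \<beta> v) ` U" using U by (intro Min_in) auto
  then obtain u where "u \<in> U" "c u / \<beta> u = Min ((\<lambda>v. c v / \<beta> v) ` U)" by auto
  then have u: "u \<in> V" "\<beta> u > 0" and umin: "\<And>v. v \<in> V \<Longrightarrow> \<beta> v > 0 \<Longrightarrow> c u / \<beta> u \<le> c v / \<beta> v"
    using U by (auto simp: U_def)
  define t where "t = c u / \<beta> u"
  have cpos: "\<And>v. v \<in> V \<Longrightarrow> c v > 0" using assms(4) by (auto simp: pos_def c_def)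
  have t: "t > 0" using u cpos by (simp add: t_def)
  have d: "c v - t * \<beta> v \<ge> 0" if "v \<in> V" for v
  proof (cases "\<beta> v > 0")
    case True
    then show ?thesis using umin[OF that True] by (simp add: t_def field_simps)
  next
    case False
    then have "t * \<beta> v \<le> 0" using t by (simp add: mult_nonneg_nonpos)
    then show ?thesis using cpos[OF that] by linarith
  qed
  define W where "W = insert b (V - {u})"
  define e where "e v = (if v = b then t else c v - t * \<beta> v)" for v
  have "b \<notin> span (V - {u})"
  proof
    assume "b \<in> span (V - {u})"
    then have "\<beta> u = 0"
      using coord_subset[OF V(2), of "V - {u}" b u] u by (auto simp: \<beta>_def)
    then show False using u by simp
  qed
  then have W: "independent W" "W \<subseteq> B" "finite W"
    using independent_mono[OF V(2), of "V - {u}"] V assms(6) unfolding W_def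
    by (auto simp: independent_insert)
  have sumW: "(\<Sum>v\<in>W. f v) = f b + (\<Sum>v\<in>V - {u}. f v)" for f :: "'a \<Rightarrow> 'z::comm_monoid_add"
    using assms(7) V(4) by (simp add: W_def)
  have sumV: "(\<Sum>v\<in>V - {u}. f v) = (\<Sum>v\<in>V. f v)" if "f u = 0" for f :: "'a \<Rightarrow> 'z::comm_monoid_add"
    using sum.remove[OF V(4) u(1), of f] that by simp
  have cu: "c u - t * \<beta> u = 0" using u by (simp add: t_def)
  have e_eq: "\<And>v. v \<in> V - {u} \<Longrightarrow> e v = c v - t * \<beta> v" and e_b: "e b = t"
    using assms(7) by (auto simp: e_def)
  have "(\<Sum>v\<in>W. e v *\<^sub>R v) = t *\<^sub>R b + (\<Sum>v\<in>V - {u}. (c v - t * \<beta> v) *\<^sub>R v)"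
    unfolding sumW e_b using e_eq by (intro arg_cong2[of _ _ _ _ "(+)"] sum.cong) auto
  also have "\<dots> = t *\<^sub>R b + (\<Sum>v\<in>V. (c v - t * \<beta> v) *\<^sub>R v)"
    by (subst sumV) (simp_all add: cu)
  also have "\<dots> = t *\<^sub>R b + ((\<Sum>v\<in>V. c v *\<^sub>R v) - t *\<^sub>R (\<Sum>v\<in>V. \<beta> v *\<^sub>R v))"
    by (simp add: scaleR_left_diff_distrib sum_subtractf scaleR_right.sum)
  also have "\<dots> = x" unfolding x b by simp
  finally have xW: "x = (\<Sum>v\<in>W. e v *\<^sub>R v)" by simp
  have "\<forall>v\<in>W. 0 \<le> e v" using d t by (auto simp: e_def W_def)
  then have "x \<in> nonneg_span W" unfolding nonneg_span_def using xW by blast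
  then have "W \<in> bases B \<and> pos W x" using generic_nonneg_span_pos assms(5) W by blast
  moreover have "interpolate W w x < interpolate V w x"
  proof -
    have "interpolate W w x = (\<Sum>v\<in>W. e v * w v)"
      unfolding xW by (rule interpolate_sum_basis[OF W(1)])
    also have "\<dots> = t * w b + (\<Sum>v\<in>V - {u}. (c v - t * \<beta> v) * w v)"
      unfolding sumW e_b using e_eq by (intro arg_cong2[of _ _ _ _ "(+)"] sum.cong) auto
    also have "\<dots> = t * w b + (\<Sum>v\<in>V. (c v - t * \<beta> v) * w v)"
      by (subst sumV) (simp_all add: cu)
    also have "\<dots> = t * w b + ((\<Sum>v\<in>V. c v * w v) - t * (\<Sum>v\<in>V. \<beta> v * w v))"
      by (simp add: left_diff_distrib sum_subtractf sum_distrib_left mult.assoc)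
    also have "\<dots> = interpolate V w x + t * (w b - interpolate V w b)"
      by (simp add: interpolate_def c_def \<beta>_def algebra_simps)
    also have "\<dots> < interpolate V w x"
      using mult_pos_neg[OF t, of "w b - interpolate V w b"] assms(8) by simp
    finally show ?thesis .
  qed
  ultimately show ?thesis by blast
qed

text \<open>The linear function of a lower facet lies below all heights and touches them only at its
  own vertices. Weighting by the positive coordinates over \<open>W\<close> compares the two
  interpolations.\<close>

lemma regular_triangulation_interpolate_le:
  assumes "V \<in> regular_triangulation B w" "W \<in> bases B" "x \<in> span B" "pos W x"
  shows "interpolate V w x \<le> interpolate W w x"
    and "\<not> W \<subseteq> V \<Longrightarrow> interpolate V w x < interpolate W w x"
proof -
  have V: "V \<in> bases B" "\<And>b. b \<in> B \<Longrightarrow> b \<notin> V \<Longrightarrow> interpolate V w b < w b"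
    using assms by (auto simp: regular_triangulation_def)
  note indV = basesD(2)[OF V(1)] and W = basesD[OF assms(2)]
  have x: "(\<Sum>v\<in>W. coord W x v *\<^sub>R v) = x" using coord_expand[OF W(2)] W(3) assms by simp
  have "interpolate V w x = interpolate V w (\<Sum>v\<in>W. coord W x v *\<^sub>R v)" using x by simp
  also have "\<dots> = (\<Sum>v\<in>W. coord W x v * interpolate V w v)"
    by (simp add: linear_sum[OF linear_interpolate[OF indV]] linear_scale[OF linear_interpolate[OF indV]])
  finally have eq: "interpolate V w x = (\<Sum>v\<in>W. coord W x v * interpolate V w v)" .
  have le: "coord W x v * interpolate V w v \<le> coord W x v * w v" if "v \<in> W" for v
  proof -
    have "interpolate V w v \<le> w v"
      using V(2)[of v] interpolate_basis[OF indV, of v w] W(1) that by (cases "v \<in> V") auto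
    moreover have "coord W x v > 0" using assms(4) that by (auto simp: pos_def)
    ultimately show ?thesis by simp
  qed
  show "interpolate V w x \<le> interpolate W w x"
    unfolding eq unfolding interpolate_def[of W] by (intro sum_mono le)
  assume "\<not> W \<subseteq> V"
  then obtain v where v: "v \<in> W" "v \<notin> V" by blast
  then have "coord W x v * interpolate V w v < coord W x v * w v"
    using V(2)[of v] W(1) assms(4) by (auto simp: pos_def)
  then show "interpolate V w x < interpolate W w x"
    unfolding eq unfolding interpolate_def[of W] using W(4) le v by (intro sum_strict_mono_ex1) auto
qed

text \<open>Existence: a basis of least height at \<open>x\<close>, among those whose open cone
  contains \<open>x\<close>, admits no pivot, and generic weights exclude ties. Uniqueness: of two
  different lower facets over one point, one would be strictly below the other and not above it,
  against symmetry.\<close>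

lemma triangulates_regular:
  assumes "finite B" "generic_weight B w" "linear \<tau>" "\<And>b. b \<in> B \<Longrightarrow> \<tau> b = (1::real)"
  shows "triangulates B (regular_triangulation B w)"
  unfolding triangulates_def
proof (intro conjI ballI impI)
  show "regular_triangulation B w \<subseteq> bases B" by (auto simp: regular_triangulation_def)
next
  fix x assume x: "x \<in> nonneg_span B" "generic B x"
  have sp: "x \<in> span B" using x nonneg_span_subset_span by blast
  define S where "S = {V\<in>bases B. pos V x}"
  obtain V0 where V0: "V0 \<subseteq> B" "independent V0" "x \<in> nonneg_span V0"
    using nonneg_span_caratheodory[of B x \<tau>] assms x by blast
  then have "V0 \<in> bases B" "pos V0 x" using generic_nonneg_span_pos[OF x(2)] by blast+
  then have S: "S \<noteq> {}" "finite S" using finite_bases[OF assms(1)] by (auto simp: S_def)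
  have "Min ((\<lambda>V. interpolate V w x) ` S) \<in> (\<lambda>V. interpolate V w x) ` S" using S by (intro Min_in) auto
  then obtain V where V: "V \<in> S" "interpolate V w x = Min ((\<lambda>V. interpolate V w x) ` S)" by auto
  then have min: "interpolate V w x \<le> interpolate W w x" if "W \<in> S" for W
    using S that by auto
  have Vb: "V \<in> bases B" "pos V x" using V by (auto simp: S_def)
  have "interpolate V w b < w b" if b: "b \<in> B" "b \<notin> V" for b
  proof (rule ccontr)
    assume "\<not> ?thesis"
    moreover have "interpolate V w b \<noteq> w b"
      using assms(2) basesD[OF Vb(1)] b span_base[OF b(1)] unfolding generic_weight_def by blast
    ultimately have "w b < interpolate V w b" by simp
    from pivot[OF assms(1) Vb(1) sp Vb(2) x(2) b this assms(3,4)]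
    obtain W where W: "W \<in> bases B" "pos W x" "interpolate W w x < interpolate V w x" by blast
    then show False using min[of W] by (auto simp: S_def)
  qed
  then show "\<exists>V\<in>regular_triangulation B w. pos V x"
    using Vb by (auto simp: regular_triangulation_def)
next
  fix V W x
  assume V: "V \<in> regular_triangulation B w" and W: "W \<in> regular_triangulation B w" and x: "x \<in> span B"
    and p: "pos V x \<and> pos W x"
  have b: "V \<in> bases B" "W \<in> bases B" using V W by (auto simp: regular_triangulation_def)
  show "V = W"
    using regular_triangulation_interpolate_le[OF V b(2) x] regular_triangulation_interpolate_le[OF W b(1) x] p
    by (meson linorder_not_less subset_antisym)
qed

section \<open>Critical pairs\<close>

text \<open>Criticality of a lifted pair: lifting raises the dimension by one, so
  \<open>dim B - 1\<close> stands for the affine dimension.\<close>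

definition lin_critical :: "nat \<Rightarrow> 'a::euclidean_space set \<Rightarrow> 'a set \<Rightarrow> bool" where
  "lin_critical k A B \<longleftrightarrow> int (card (A + ksum k B)) = critical_size (dim B - 1) k (card A)"

locale sumset_pair =
  fixes \<tau> :: "'a::euclidean_space \<Rightarrow> real" and A B :: "'a set"
  assumes linear_level: "linear \<tau>"
    and finite_A: "finite A"
    and finite_B: "finite B"
    and B_nonempty: "B \<noteq> {}"
    and level_B: "b \<in> B \<Longrightarrow> \<tau> b = 1"
    and A_subset: "A \<subseteq> nonneg_span B"
    and level_A: "a \<in> A \<Longrightarrow> \<tau> a = 1"
begin

lemma half_open_intro:
  assumes "triangulates B T" "p \<in> nonneg_span B" "generic B p"
  shows "half_open \<tau> B T p"
  unfolding half_open_def using assms linear_level finite_B level_B by blast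

lemma triangulates_regular_weight: "generic_weight B w \<Longrightarrow> triangulates B (regular_triangulation B w)"
  using triangulates_regular[OF finite_B _ linear_level level_B] by blast

lemma ex_half_open: "\<exists>T p. half_open \<tau> B T p"
  using ex_generic_weight[OF finite_B] ex_generic[OF finite_B subset_refl refl]
    triangulates_regular_weight half_open_intro by metis

lemma finite_sumset: "finite (A + ksum k B)"
  by (intro finite_set_plus finite_A finite_ksum finite_B)

text \<open>The cell sum has at least the critical number of elements and lies in a sumset of
  exactly that size. Criticality is exploited below through this equality, for a tiling and
  direction of choice.\<close>

lemma cell_sum_critical:
  assumes "half_open \<tau> B T p" "lin_critical k A B"
  shows "half_open.cell_sum T p k A = A + ksum k B"
proof -
  interpret H: half_open \<tau> B T p by fact
  have "card (A + ksum k B) \<le> card (H.cell_sum k A)"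
    using H.card_cell_sum_ge[OF B_nonempty finite_A A_subset level_A, of k] assms(2)
    by (simp add: lin_critical_def)
  then show ?thesis
    by (intro card_seteq finite_sumset H.cell_sum_subset A_subset)
qed

lemma cell_0_critical:
  assumes "half_open \<tau> B T p" "lin_critical k A B" "dim B \<ge> 2" "k \<ge> 1"
  shows "half_open.cell T p 0 \<subseteq> A"
proof (rule ccontr)
  interpret H: half_open \<tau> B T p by fact
  assume "\<not> ?thesis"
  then have "critical_size (dim B - 1) k (card A) < int (card (H.cell_sum k A))"
    using H.card_cell_sum_gt[OF B_nonempty finite_A A_subset level_A] assms by blast
  then show False
    using cell_sum_critical[OF assms(1,2)] assms(2) by (simp add: lin_critical_def)
qed

text \<open>With \<open>B \<subseteq> A\<close> the excess vanishes, so one tiling whose translates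
  exhaust the sumset certifies criticality.\<close>

lemma critical_cell_sum:
  assumes "half_open \<tau> B T p" "B \<subseteq> A" "A + ksum k B \<subseteq> half_open.cell_sum T p k A"
  shows "lin_critical k A B"
proof -
  interpret H: half_open \<tau> B T p by fact
  have "H.cell 0 \<subseteq> A" using H.TD(1)[OF H.cell_0(1)] assms(2) by blast
  moreover have "H.cell_sum k A = A + ksum k B"
    using H.cell_sum_subset[OF A_subset] assms(3) by blast
  ultimately show ?thesis
    using H.card_cell_sum_eq[OF B_nonempty finite_A A_subset level_A, of k] by (metis lin_critical_def)
qed

text \<open>A low weight at \<open>b\<close> puts \<open>b\<close> into every cell. A direction
  chosen inside one of them turns it into \<open>cell 0\<close>, which lies in
  \<open>A\<close>.\<close>

lemma critical_vertices_subset: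
  assumes "lin_critical k A B" "dim B \<ge> 2" "k \<ge> 1"
  shows "B \<subseteq> A"
proof
  fix b assume b: "b \<in> B"
  obtain w where w: "generic_weight B w" "\<forall>V\<subseteq>B - {b}. interpolate V w b > w b"
    using ex_generic_weight_low[OF finite_B b] by blast
  define T where "T = regular_triangulation B w"
  have T: "triangulates B T" using triangulates_regular_weight[OF w(1)] T_def by simp
  obtain p where p: "p \<in> nonneg_span B" "generic B p" using ex_generic[OF finite_B subset_refl refl] by blast
  interpret H: half_open \<tau> B T p by (intro half_open_intro T p)
  define V where "V = H.cell b"
  have V: "V \<in> T" using H.cell(1) nonneg_span_base[OF finite_B b] by (simp add: V_def)
  have bV: "b \<in> V"
  proof (rule ccontr)
    assume "b \<notin> V"
    then have "interpolate V w b < w b" "V \<subseteq> B - {b}"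
      using V b H.TD(1)[OF V] by (auto simp: T_def regular_triangulation_def)
    then show False using w(2)[rule_format, of V] by linarith
  qed
  obtain p' where p': "p' \<in> nonneg_span V" "generic B p'"
    using ex_generic[OF finite_B H.TD(1)[OF V] H.TD(3)[OF V]] by blast
  have p'B: "p' \<in> nonneg_span B" using p' H.nonneg_span_T[OF V] by blast
  interpret H': half_open \<tau> B T p' by (intro half_open_intro T p'B p')
  have "pos V p'" using generic_nonneg_span_pos[OF p'(2) H.TD(2,1)[OF V] p'(1)] by blast
  then have "lex_pos p' V 0"
    using H.TD(2)[OF V] by (simp add: lex_pos_def pos_def coord_linear_simps)
  then have "H'.cell 0 = V" using H'.cellI[OF V span_0] by blast
  then show "b \<in> A" using cell_0_critical[OF H'.half_open_axioms assms] bV by blast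
qed

text \<open>Add to \<open>x\<close> a vertex \<open>v\<close> of its cell at which \<open>x\<close>
  is positive. The sum splits as \<open>a + y\<close> in the same cell; as \<open>a\<close> has
  coordinate at most 1 at \<open>v\<close>, that of \<open>y\<close> is positive, and cancelling
  \<open>v\<close> decomposes \<open>x\<close>.\<close>

lemma critical_decrease:
  assumes "B \<subseteq> A" "lin_critical (Suc k) A B"
  shows "lin_critical k A B"
proof -
  obtain T p where "half_open \<tau> B T p" using ex_half_open by blast
  then interpret H: half_open \<tau> B T p .
  have "x \<in> H.cell_sum k A" if x: "x \<in> A + ksum k B" for x
  proof -
    obtain a0 y0 where x0: "a0 \<in> A" "y0 \<in> ksum k B" "x = a0 + y0" using x by (auto simp: set_plus_def)
    have xn: "x \<in> nonneg_span B"
      unfolding x0(3) using x0(1,2) A_subset ksum_nonneg_span[OF finite_B, of k] by (intro nonneg_span_add) auto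
    have tx: "\<tau> x = 1 + real k"
      using x0 level_A ksum_level[OF linear_level level_B x0(2)] by (simp add: linear_add[OF linear_level])
    define V where "V = H.cell x"
    have V: "V \<in> T" "lex_pos p V x" using H.cell[OF xn] by (auto simp: V_def)
    note VD = H.TD[OF V(1)]
    have "(\<Sum>v\<in>V. coord V x v) > 0"
      using H.level_coord[OF V(1) H.in_span[OF xn]] tx by simp
    then obtain v where v: "v \<in> V" "coord V x v > 0" using sum_nonpos[of V "coord V x"] by (meson not_less)
    have "x + v = a0 + (y0 + v)" using x0 by (simp add: add.assoc)
    moreover have "y0 + v \<in> ksum (Suc k) B" using x0 v VD(1) by auto
    ultimately have "x + v \<in> A + ksum (Suc k) B" using x0(1) by (metis set_plus_intro)
    then have "x + v \<in> H.cell_sum (Suc k) A"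
      using cell_sum_critical[OF H.half_open_axioms assms(2)] by simp
    then obtain a y where a: "a \<in> A" "y \<in> ksum (Suc k) (H.cell a)" "x + v = a + y"
      unfolding H.cell_sum_def by blast
    have an: "a \<in> nonneg_span B" using a A_subset by blast
    have "H.cell (x + v) = V"
      unfolding V_def using H.cell_add[OF xn] nonneg_span_base[OF VD(4) v(1)] V_def by simp
    moreover have "H.cell (a + y) = H.cell a"
      using H.cell_add[OF an] ksum_nonneg_span[OF H.TD(4)[OF H.cell(1)[OF an]], of "Suc k"] a(2) by blast
    ultimately have Va: "H.cell a = V" using a(3) by simp
    have "coord V a v \<le> 1"
      using H.level1_coord_le[OF V(1) _ level_A[OF a(1)] v(1)] H.cell_nonneg_span[OF an] Va by simp
    moreover have "coord V x v + 1 = coord V a v + coord V y v"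
      using arg_cong[OF a(3), of "\<lambda>z. coord V z v"] coord_basis[OF VD(2) v(1), of v]
      by (simp add: coord_linear_simps[OF VD(2)])
    ultimately have "coord V y v \<noteq> 0" using v(2) by linarith
    then have "y - v \<in> ksum k V" using ksum_remove[OF VD(2) _ v(1)] a(2) Va by simp
    moreover have "x = a + (y - v)" using a(3) by (simp add: algebra_simps)
    ultimately show ?thesis
      unfolding H.cell_sum_def using a(1) Va by blast
  qed
  then show ?thesis using critical_cell_sum[OF H.half_open_axioms assms(1)] by blast
qed

text \<open>After a shift of \<open>p\<close> only \<open>u\<close> and \<open>v\<close> are
  negative, so \<open>v + k u\<close> is in the half-open cell of \<open>V\<close>. Its base point
  would have to be a vertex of \<open>V\<close> in that half-open cell, but \<open>v\<close> fails
  at its zero coordinate \<open>u\<close>, and every other vertex fails at \<open>v\<close>.\<close>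

lemma critical_two_negative_coords:
  assumes "B \<subseteq> A" "lin_critical k A B" "k \<ge> 1" "half_open \<tau> B T p" "V \<in> T"
    and uv: "u \<in> V" "v \<in> V" "u \<noteq> v" "coord V p u < 0" "coord V p v < 0"
  shows False
proof -
  interpret H: half_open \<tau> B T p by fact
  note V = H.TD[OF assms(5)]
  define s where "s = (\<Sum>w\<in>V - {u, v}. 1 *\<^sub>R w)"
  have s_coord: "coord V s w = (if w \<in> V - {u, v} then 1 else 0)" if "w \<in> V" for w
    unfolding s_def using coord_sum_basis[OF V(2) that, of "V - {u, v}" "\<lambda>_. 1"] by auto
  have s_nn: "s \<in> nonneg_span B"
    unfolding s_def using V(1) nonneg_span_base[OF finite_B] by (intro nonneg_span_sum nonneg_span_scale) auto
  \<comment> \<open>The values of \<open>M\<close> for which the shifted direction would lie on a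
    wall.\<close>
  define X where "X = (\<Union>W\<in>bases B. (\<lambda>w. - coord W p w / coord W s w) ` W)"
  have "finite X" unfolding X_def using finite_bases[OF finite_B] basesD(4)[of _ B] by blast
  \<comment> \<open>Beyond this bound all coordinates other than those at \<open>u\<close> and
    \<open>v\<close> become positive; the inserted 0 makes \<open>M\<close> positive.\<close>
  define M0 where "M0 = Max (insert 0 ((\<lambda>w. - coord V p w) ` V))"
  obtain M where M: "M > M0" "M \<notin> X" using infinite_gt_avoid[OF \<open>finite X\<close>] by blast
  have M0: "M0 \<ge> 0" "\<And>w. w \<in> V \<Longrightarrow> - coord V p w \<le> M0"
    unfolding M0_def using V(4) by auto
  define p' where "p' = p + M *\<^sub>R s"
  have p'_nn: "p' \<in> nonneg_span B"
    unfolding p'_def using H.p_nonneg s_nn M M0 by (intro nonneg_span_add nonneg_span_scale) auto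
  have p'_gen: "generic B p'"
    unfolding generic_def
  proof (intro ballI)
    fix W w assume W: "W \<in> bases B" "w \<in> W"
    have "coord W p w + M * coord W s w \<noteq> 0"
    proof (rule affine_root_avoid)
      show "M \<noteq> - coord W p w / coord W s w" using M(2) W by (auto simp: X_def)
    qed (use H.p_generic W in \<open>auto simp: generic_def\<close>)
    then show "coord W p' w \<noteq> 0"
      by (simp add: p'_def coord_linear_simps[OF basesD(2)[OF W(1)]])
  qed
  interpret H': half_open \<tau> B T p' by (intro half_open_intro H.triang p'_nn p'_gen)
  have neg: "coord V p' u < 0" "coord V p' v < 0"
    using uv s_coord[of u] s_coord[of v] by (simp_all add: p'_def coord_linear_simps[OF V(2)])
  have posi: "coord V p' w > 0" if "w \<in> V" "w \<noteq> u" "w \<noteq> v" for w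
    using s_coord[of w] M0(2)[OF that(1)] M(1) that by (simp add: p'_def coord_linear_simps[OF V(2)])
  define y where "y = v + real k *\<^sub>R u"
  have ku: "real k *\<^sub>R u \<in> ksum k V" using uv scaleR_ksum by blast
  have "y \<in> A + ksum k B"
    using ku ksum_mono[OF V(1), of k] uv V(1) assms(1) by (auto simp: y_def)
  then have "y \<in> H'.cell_sum k A"
    using cell_sum_critical[OF H'.half_open_axioms assms(2)] by simp
  then obtain a z where a: "a \<in> A" "z \<in> ksum k (H'.cell a)" "y = a + z"
    unfolding H'.cell_sum_def by blast
  have y_coord: "coord V y w = (if w = v then 1 else 0) + real k * (if w = u then 1 else 0)" for w
    using coord_basis[OF V(2) uv(1), of w] coord_basis[OF V(2) uv(2), of w]
    by (simp add: y_def coord_linear_simps[OF V(2)])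
  have "lex_pos p' V y"
    unfolding lex_pos_def using y_coord posi uv(3) assms(3) by auto
  moreover have y_sp: "y \<in> span B"
    using uv V(1) span_base unfolding y_def by (intro span_add span_scale) blast+
  ultimately have Vy: "H'.cell y = V" using H'.cellI assms(5) by blast
  have an: "a \<in> nonneg_span B" using a A_subset by blast
  have "H'.cell (a + z) = H'.cell a"
    using H'.cell_add[OF an] ksum_nonneg_span[OF H'.TD(4)[OF H'.cell(1)[OF an]], of k] a(2) by blast
  then have Va: "H'.cell a = V" using Vy a(3) by simp
  have a_nn: "a \<in> nonneg_span V" using H'.cell_nonneg_span[OF an] Va by simp
  have a_lex: "lex_pos p' V a" using H'.cell(2)[OF an] Va by simp
  have "a \<noteq> v"
    using a_lex coord_basis[OF V(2) uv(2), of u] uv neg unfolding lex_pos_def by force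
  have "coord V a w - coord V v w \<in> \<int>" for w
  proof -
    have "coord V a w - coord V v w = coord V (real k *\<^sub>R u) w - coord V z w"
      using arg_cong[OF a(3), of "\<lambda>z. coord V z w"] by (simp add: y_def coord_linear_simps[OF V(2)])
    also have "\<dots> \<in> \<int>"
      using ksum_coord_Nats[OF V(2) ku, of w] ksum_coord_Nats[OF V(2), of z k w] a(2) Va Nats_subset_Ints
      by (intro Ints_diff) auto
    finally show ?thesis .
  qed
  then have "a \<in> V"
    using H.level1_differ_Ints[OF assms(5) a_nn nonneg_span_base[OF V(4) uv(2)] level_A[OF a(1)] level_B]
      uv V(1) \<open>a \<noteq> v\<close> by blast
  then have "coord V a v = 0" using coord_basis[OF V(2)] \<open>a \<noteq> v\<close> by auto
  then show False using a_lex neg uv unfolding lex_pos_def by force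
qed

text \<open>Every cell contains \<open>b\<close> by the choice of weights. A small step from
  \<open>b\<close> against \<open>p\<close> stays in the cone by \<open>inner\<close>; in the cell
  it enters, \<open>p\<close> is negative at all vertices other than \<open>b\<close>, and there are
  at least two of them.\<close>

lemma critical_no_interior_vertex:
  assumes "B \<subseteq> A" "lin_critical k A B" "k \<ge> 1" "dim B \<ge> 3" "b \<in> B"
    and inner: "\<And>x. x \<in> nonneg_span B \<Longrightarrow> \<exists>d>0. b - d *\<^sub>R x \<in> nonneg_span B"
  shows False
proof -
  obtain w where w: "generic_weight B w" "\<forall>V\<subseteq>B - {b}. interpolate V w b > w b"
    using ex_generic_weight_low[OF finite_B assms(5)] by blast
  define T where "T = regular_triangulation B w"
  have T: "triangulates B T" using triangulates_regular_weight[OF w(1)] T_def by simp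
  obtain p where p: "p \<in> nonneg_span B" "generic B p" using ex_generic[OF finite_B subset_refl refl] by blast
  interpret H: half_open \<tau> B T p by (intro half_open_intro T p)
  obtain d where d: "d > 0" "b - d *\<^sub>R p \<in> nonneg_span B" using inner[OF p(1)] by blast
  have "generic B (- p)"
    using p(2) by (auto simp: generic_def coord_linear_simps[OF basesD(2)])
  note ev = eventually_perturb_generic[OF finite_B this, of b]
  have "eventually (\<lambda>e. e \<in> {0<..<d}) (at_right 0)" by (rule eventually_at_right_real[OF d(1)])
  with ev have "eventually (\<lambda>e. e \<in> {0<..<d} \<and> generic B (b + e *\<^sub>R - p) \<and>
      (\<forall>V\<in>bases B. pos V (b + e *\<^sub>R - p) \<longleftrightarrow> lex_pos (- p) V b)) (at_right 0)"
    by eventually_elim auto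
  from eventually_happens'[OF trivial_limit_at_right_real this]
  obtain e where e0: "e \<in> {0<..<d} \<and> generic B (b + e *\<^sub>R - p) \<and>
      (\<forall>V\<in>bases B. pos V (b + e *\<^sub>R - p) \<longleftrightarrow> lex_pos (- p) V b)" ..
  then have e: "0 < e" "e < d" "generic B (b + e *\<^sub>R - p)"
      "\<forall>V\<in>bases B. pos V (b + e *\<^sub>R - p) \<longleftrightarrow> lex_pos (- p) V b"
    by (simp, simp, blast, blast)
  \<comment> \<open>A convex combination of two points of the cone, because
    \<open>e < d\<close>.\<close>
  have "b + e *\<^sub>R - p = (1 - e / d) *\<^sub>R b + (e / d) *\<^sub>R (b - d *\<^sub>R p)"
    using d(1) by (simp add: algebra_simps)
  also have "\<dots> \<in> nonneg_span B"
    using d e nonneg_span_base[OF finite_B assms(5)]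
    by (intro nonneg_span_add nonneg_span_scale) (auto simp: field_simps)
  finally obtain V where V: "V \<in> T" "pos V (b + e *\<^sub>R - p)"
    using T e(3) unfolding triangulates_def by blast
  note VD = H.TD[OF V(1)]
  have lex: "lex_pos (- p) V b" using e(4) V H.T_bases by blast
  have bV: "b \<in> V"
  proof (rule ccontr)
    assume "b \<notin> V"
    then have "interpolate V w b < w b" "V \<subseteq> B - {b}"
      using V assms(5) VD(1) by (auto simp: T_def regular_triangulation_def)
    then show False using w(2)[rule_format, of V] by linarith
  qed
  have neg: "coord V p v < 0" if "v \<in> V" "v \<noteq> b" for v
    using lex coord_basis[OF VD(2) bV, of v] that by (auto simp: lex_pos_def coord_linear_simps[OF VD(2)])
  have "card (V - {b}) \<ge> 2" using VD(4,5) assms(4) bV by simp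
  then obtain u v where "u \<in> V - {b}" "v \<in> V - {b}" "u \<noteq> v"
    using card_le_Suc0_iff_eq[of "V - {b}"] VD(4) by force
  then show False
    using critical_two_negative_coords[OF assms(1-3) H.half_open_axioms V(1), of u v] neg by auto
qed

text \<open>Points outside \<open>cell 0\<close> biject with cells other than \<open>cell 0\<close>.
  Two vertices sharing a half-open cell would make it \<open>cell 0\<close>. Conversely such a cell
  has exactly one vertex with \<open>p\<close> negative, and it is the cell of that vertex.\<close>

lemma critical_card_triangulation:
  assumes "B \<subseteq> A" "lin_critical k A B" "k \<ge> 1" "triangulates B T"
    and vert: "\<And>V b. V \<in> T \<Longrightarrow> b \<in> B \<Longrightarrow> b \<in> nonneg_span V \<Longrightarrow> b \<in> V"
  shows "int (card T) = int (card B) - (int (dim B) - 1)"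
proof -
  obtain p where p: "p \<in> nonneg_span B" "generic B p" using ex_generic[OF finite_B subset_refl refl] by blast
  interpret H: half_open \<tau> B T p by (intro half_open_intro assms(4) p)
  have mem: "b \<in> H.cell b" "H.cell b \<in> T" "lex_pos p (H.cell b) b" if "b \<in> B" for b
    using H.cell[OF nonneg_span_base[OF finite_B that]] H.cell_nonneg_span[OF nonneg_span_base[OF finite_B that]]
      vert[OF _ that] by blast+
  have coordp: "coord (H.cell b) p v > 0" if "b \<in> B" "v \<in> H.cell b" "v \<noteq> b" for b v
    using mem[OF that(1)] coord_basis[OF H.TD(2)[OF mem(2)[OF that(1)]] mem(1)[OF that(1)], of v] that
    by (auto simp: lex_pos_def)
  have finT: "finite T" by (rule finite_subset[OF _ finite_bases[OF finite_B]]) (use H.T_bases in blast)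
  have "bij_betw H.cell (B - H.cell 0) (T - {H.cell 0})"
    unfolding bij_betw_def
  proof
    show "inj_on H.cell (B - H.cell 0)"
    proof
      fix b c assume b: "b \<in> B - H.cell 0" and c: "c \<in> B - H.cell 0" and eq: "H.cell b = H.cell c"
      show "b = c"
      proof (rule ccontr)
        assume "b \<noteq> c"
        then have "H.cell 0 = H.cell b"
          using H.cell_0_eq[of "H.cell b" b c] mem[of b] mem[of c] b c eq by auto
        then show False using mem(1)[of b] b by auto
      qed
    qed
    show "H.cell ` (B - H.cell 0) = T - {H.cell 0}"
    proof
      show "H.cell ` (B - H.cell 0) \<subseteq> T - {H.cell 0}"
      proof (intro image_subsetI DiffI)
        fix b assume b: "b \<in> B - H.cell 0"
        then show "H.cell b \<in> T" using mem by blast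
        show "H.cell b \<notin> {H.cell 0}" using mem(1)[of b] b by auto
      qed
      show "T - {H.cell 0} \<subseteq> H.cell ` (B - H.cell 0)"
      proof
        fix V assume V: "V \<in> T - {H.cell 0}"
        note VD = H.TD[of V]
        have "\<exists>v\<in>V. coord V p v < 0"
        proof (rule ccontr)
          assume "\<not> ?thesis"
          then have "\<forall>v\<in>V. coord V p v > 0"
            using p(2) H.T_bases V unfolding generic_def by (metis DiffD1 linorder_neqE_linordered_idom)
          then have "lex_pos p V 0" using VD(2) V by (simp add: lex_pos_def coord_linear_simps)
          then show False using H.cellI[of V 0] V span_0 by auto
        qed
        then obtain v where v: "v \<in> V" "coord V p v < 0" by blast
        have "coord V p u > 0" if "u \<in> V" "u \<noteq> v" for u
          using critical_two_negative_coords[OF assms(1-3) H.half_open_axioms, of V u v] p(2) H.T_bases V v that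
          unfolding generic_def by (metis DiffD1 linorder_neqE_linordered_idom)
        then have "lex_pos p V v"
          using coord_basis[OF VD(2) v(1)] V unfolding lex_pos_def by auto
        then have cv: "H.cell v = V" using H.cellI[of V v] V v VD(1) span_base by blast
        moreover have "v \<notin> H.cell 0" using H.cell_vertex_0[of v] cv V by auto
        ultimately show "V \<in> H.cell ` (B - H.cell 0)" using V v VD(1) by blast
      qed
    qed
  qed
  then have "card (B - H.cell 0) = card (T - {H.cell 0})" by (rule bij_betw_same_card)
  moreover have "card (B - H.cell 0) + dim B = card B"
    using H.TD[OF H.cell_0(1)] finite_B by (metis card_Diff_subset card_mono le_add_diff_inverse2)
  moreover have "card (T - {H.cell 0}) + 1 = card T"
    using H.cell_0(1) finT by (metis Suc_eq_plus1 card_Suc_Diff1)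
  ultimately show ?thesis by linarith
qed

end

section \<open>Passing to subsets\<close>

context sumset_pair
begin

lemma sumset_pair_subset:
  assumes "C \<subseteq> B" "C \<noteq> {}"
  shows "sumset_pair \<tau> (A \<inter> nonneg_span C) C"
  unfolding sumset_pair_def
  using assms linear_level finite_A finite_subset[OF assms(1) finite_B] level_B level_A by blast

text \<open>Give \<open>b\<close> a high weight and take \<open>p\<close> in the cone over the other
  points. The tiling of the smaller cone is then part of the larger one with the same half-open
  cells, so the decomposition of a sum for \<open>B\<close> already lives in the smaller
  pair.\<close>

lemma critical_remove_same_span:
  assumes "B \<subseteq> A" "lin_critical k A B" "b \<in> B" "span (B - {b}) = span B" "B - {b} \<noteq> {}"
  shows "lin_critical k (A \<inter> nonneg_span (B - {b})) (B - {b})"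
proof -
  define B' where "B' = B - {b}"
  define A' where "A' = A \<inter> nonneg_span B'"
  have B': "B' \<subseteq> B" "span B' = span B" "B' \<noteq> {}" "finite B'" using assms finite_B by (auto simp: B'_def)
  interpret P': sumset_pair \<tau> A' B' unfolding A'_def by (rule sumset_pair_subset[OF B'(1,3)])
  obtain w where w: "generic_weight B w" "\<forall>V\<subseteq>B - {b}. interpolate V w b < w b"
    using ex_generic_weight_high[OF finite_B assms(3)] by blast
  obtain p where p: "p \<in> nonneg_span B'" "generic B p" using ex_generic[OF finite_B B'(1,2)] by blast
  have nn: "nonneg_span B' \<subseteq> nonneg_span B" using nonneg_span_mono[OF finite_B B'(1)] .
  have bases: "bases B' \<subseteq> bases B" using B'(1,2) by (auto simp: bases_def)
  then have p': "generic B' p" using p(2) by (auto simp: generic_def)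
  define T where "T = regular_triangulation B w"
  define T' where "T' = regular_triangulation B' w"
  have TT: "T' \<subseteq> T"
  proof
    fix V assume "V \<in> T'"
    then have V: "V \<in> bases B'" "\<forall>c\<in>B' - V. interpolate V w c < w c" by (auto simp: T'_def regular_triangulation_def)
    have "interpolate V w b < w b" using w(2) basesD(1)[OF V(1)] by (simp add: B'_def)
    then have "\<forall>c\<in>B - V. interpolate V w c < w c" using V(2) by (auto simp: B'_def)
    then show "V \<in> T" using V(1) bases by (auto simp: T_def regular_triangulation_def)
  qed
  interpret H: half_open \<tau> B T p
    unfolding T_def using triangulates_regular_weight[OF w(1)] p nn by (intro half_open_intro) auto
  interpret H': half_open \<tau> B' T' p
    unfolding T'_def using P'.triangulates_regular_weight[OF generic_weight_subset[OF w(1) B'(1)]] p p'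
    by (intro P'.half_open_intro) auto
  have "x \<in> H'.cell_sum k A'" if x: "x \<in> A' + ksum k B'" for x
  proof -
    have xn: "x \<in> nonneg_span B'"
      using x nonneg_span_add ksum_nonneg_span[OF B'(4), of k] by (auto simp: A'_def elim!: set_plus_elim)
    have "x \<in> A + ksum k B"
      using x set_plus_mono2[of A' A "ksum k B'" "ksum k B"] ksum_mono[OF B'(1), of k] by (auto simp: A'_def)
    then have "x \<in> H.cell_sum k A"
      using cell_sum_critical[OF H.half_open_axioms assms(2)] by simp
    then obtain a y where a: "a \<in> A" "y \<in> ksum k (H.cell a)" "x = a + y"
      unfolding H.cell_sum_def by blast
    have an: "a \<in> nonneg_span B" using a A_subset by blast
    have "H.cell x = H.cell a"
      using H.cell_add[OF an] ksum_nonneg_span[OF H.TD(4)[OF H.cell(1)[OF an]], of k] a(2,3) by blast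
    moreover have "H.cell x = H'.cell x"
      using H.cellI[of "H'.cell x" x] H'.cell[OF xn] TT H'.in_span[OF xn] B'(2) by auto
    ultimately have ca: "H.cell a = H'.cell x" by simp
    have VT: "H.cell a \<in> T'" using H'.cell(1)[OF xn] ca by simp
    have "a \<in> nonneg_span B'"
      using H.cell_nonneg_span[OF an] H'.nonneg_span_T[OF VT] by blast
    then have a': "a \<in> A'" "H'.cell a = H.cell a"
      using a(1) H'.cellI[OF VT H'.in_span H.cell(2)[OF an]] by (auto simp: A'_def)
    have "x \<in> (+) a ` ksum k (H'.cell a)" using a(2,3) unfolding a'(2) by (rule image_eqI[rotated])
    then show ?thesis unfolding H'.cell_sum_def using a'(1) by (rule UN_I[rotated])
  qed
  moreover have "B' \<subseteq> A'" using assms(1) B'(1) nonneg_span_base[OF B'(4)] by (auto simp: A'_def)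
  ultimately have "lin_critical k A' B'"
    using P'.critical_cell_sum[OF H'.half_open_axioms] by blast
  then show ?thesis by (simp add: A'_def B'_def)
qed

text \<open>Here \<open>b\<close> is the apex of a pyramid: cells of the base with \<open>b\<close>
  adjoined are cells of the whole, and \<open>p'\<close> is \<open>p\<close> without its
  \<open>b\<close> term. A sum from the base has coordinate 0 at \<open>b\<close>, so by
  nonnegativity neither of its summands involves \<open>b\<close>.\<close>

lemma critical_remove_apex:
  assumes "B \<subseteq> A" "lin_critical k A B" "b \<in> B" "b \<notin> span (B - {b})" "B - {b} \<noteq> {}"
  shows "lin_critical k (A \<inter> nonneg_span (B - {b})) (B - {b})"
proof -
  define B' where "B' = B - {b}"
  define A' where "A' = A \<inter> nonneg_span B'"
  have B': "B' \<subseteq> B" "b \<notin> span B'" "B' \<noteq> {}" "finite B'" "B = insert b B'" using assms finite_B by (auto simp: B'_def)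
  interpret P': sumset_pair \<tau> A' B' unfolding A'_def by (rule sumset_pair_subset[OF B'(1,3)])
  obtain w where w: "generic_weight B w" using ex_generic_weight[OF finite_B] by blast
  obtain p where p: "p \<in> nonneg_span B" "generic B p" using ex_generic[OF finite_B subset_refl refl] by blast
  obtain \<mu> where \<mu>: "\<forall>c\<in>B. 0 \<le> \<mu> c" "p = (\<Sum>c\<in>B. \<mu> c *\<^sub>R c)" using p(1) by (auto simp: nonneg_span_def)
  define p' where "p' = (\<Sum>c\<in>B'. \<mu> c *\<^sub>R c)"
  have pp': "p = p' + \<mu> b *\<^sub>R b"
    using \<mu>(2) sum.remove[OF finite_B assms(3), of "\<lambda>c. \<mu> c *\<^sub>R c"] by (simp add: p'_def B'_def)
  have p'n: "p' \<in> nonneg_span B'" unfolding p'_def nonneg_span_def using \<mu>(1) B'(1) by blast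
  have nn: "nonneg_span B' \<subseteq> nonneg_span B" using nonneg_span_mono[OF finite_B B'(1)] .
  have ins: "insert b V \<in> bases B" "b \<notin> V" "b \<notin> span V" if V: "V \<in> bases B'" for V
  proof -
    note VD = basesD[OF V]
    show bs: "b \<notin> span V" using VD B'(2) by simp
    show "b \<notin> V" using bs span_base by blast
    have "independent (insert b V)" using bs VD(2) by (simp add: independent_insert)
    moreover have "insert b V \<subseteq> B" using VD(1) B'(5) by blast
    moreover have "span (insert b V) = span B" unfolding B'(5) using VD(3) by (simp add: span_insert)
    ultimately show "insert b V \<in> bases B" by (simp add: bases_def)
  qed
  have crd: "coord (insert b V) x v = (if v \<in> V then coord V x v else 0)"
    if "V \<in> bases B'" "x \<in> span B'" "v \<in> insert b V" for V x v
    using coord_subset[OF basesD(2)[OF ins(1)[OF that(1)]] subset_insertI, of x v] basesD(3)[OF that(1)] that by auto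
  have crdp: "coord (insert b V) p v = coord V p' v" if "V \<in> bases B'" "v \<in> V" for V v
  proof -
    note ind = basesD(2)[OF ins(1)[OF that(1)]]
    have "coord (insert b V) b v = 0" using coord_basis[OF ind, of b v] ins(2)[OF that(1)] that(2) by auto
    then show ?thesis
      using crd[OF that(1), of p' v] p'n nonneg_span_subset_span that unfolding pp' coord_linear_simps[OF ind] by auto
  qed
  \<comment> \<open>This coordinate is the coefficient of \<open>b\<close> in \<open>p\<close>,
    nonnegative by choice and nonzero by genericity. It lets points of the base belong to the
    half-open pyramid.\<close>
  have crdpb: "coord (insert b V) p b > 0" if "V \<in> bases B'" for V
  proof -
    note ind = basesD(2)[OF ins(1)[OF that(1)]]
    have "coord (insert b V) b b = 1" using coord_basis[OF ind, of b b] by simp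
    moreover have "coord (insert b V) p' b = 0"
      using crd[OF that, of p' b] p'n nonneg_span_subset_span ins(2)[OF that] by auto
    ultimately have "coord (insert b V) p b = \<mu> b" unfolding pp' coord_linear_simps[OF ind] by simp
    moreover have "coord (insert b V) p b \<noteq> 0" using p(2) ins(1)[OF that] by (auto simp: generic_def)
    moreover have "\<mu> b \<ge> 0" using \<mu>(1) assms(3) by blast
    ultimately show ?thesis by linarith
  qed
  have p'g: "generic B' p'"
    unfolding generic_def
  proof (intro ballI)
    fix V v assume V: "V \<in> bases B'" "v \<in> V"
    have "coord (insert b V) p v \<noteq> 0" using p(2) ins(1)[OF V(1)] V(2) by (auto simp: generic_def)
    then show "coord V p' v \<noteq> 0" using crdp[OF V] by simp
  qed
  define T where "T = regular_triangulation B w"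
  define T' where "T' = regular_triangulation B' w"
  have TT: "insert b V \<in> T" if "V \<in> T'" for V
  proof -
    have V: "V \<in> bases B'" "\<forall>c\<in>B' - V. interpolate V w c < w c"
      using that by (auto simp: T'_def regular_triangulation_def)
    have "interpolate (insert b V) w c < w c" if c: "c \<in> B - insert b V" for c
    proof -
      have cB: "c \<in> B'" "c \<notin> V" using c B'(5) by auto
      have "interpolate (insert b V) w c = interpolate V w c"
        using crd[OF V(1) span_base[OF cB(1)]] basesD(4)[OF V(1)] ins(2)[OF V(1)] by (simp add: interpolate_def)
      then show ?thesis using V(2) cB by auto
    qed
    then show ?thesis using ins(1)[OF V(1)] by (auto simp: T_def regular_triangulation_def)
  qed
  interpret H: half_open \<tau> B T p
    unfolding T_def using triangulates_regular_weight[OF w(1)] p nn by (intro half_open_intro) auto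
  interpret H': half_open \<tau> B' T' p'
    unfolding T'_def using P'.triangulates_regular_weight[OF generic_weight_subset[OF w(1) B'(1)]] p'n p'g
    by (intro P'.half_open_intro) auto
  have cells: "H.cell x = insert b (H'.cell x)" if x: "x \<in> nonneg_span B'" for x
  proof (rule H.cellI)
    show "insert b (H'.cell x) \<in> T" using TT H'.cell(1)[OF x] by blast
    show "x \<in> span B" using x nn H.in_span by blast
    have Vb: "H'.cell x \<in> bases B'" using H'.T_bases H'.cell(1)[OF x] by blast
    have "0 < coord (insert b (H'.cell x)) x v \<or> coord (insert b (H'.cell x)) x v = 0 \<and> 0 < coord (insert b (H'.cell x)) p v"
      if v: "v \<in> insert b (H'.cell x)" for v
    proof (cases "v = b")
      case True
      then show ?thesis
        using crd[OF Vb H'.in_span[OF x] v] ins(2)[OF Vb] crdpb[OF Vb] by simp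
    next
      case False
      then have v': "v \<in> H'.cell x" using v by simp
      then show ?thesis
        using crd[OF Vb H'.in_span[OF x] v] crdp[OF Vb v'] H'.cell(2)[OF x] unfolding lex_pos_def by auto
    qed
    then show "lex_pos p (insert b (H'.cell x)) x" unfolding lex_pos_def by blast
  qed
  have "x \<in> H'.cell_sum k A'" if x: "x \<in> A' + ksum k B'" for x
  proof -
    have xn: "x \<in> nonneg_span B'"
      using x nonneg_span_add ksum_nonneg_span[OF B'(4), of k] by (auto simp: A'_def elim!: set_plus_elim)
    have "x \<in> A + ksum k B"
      using x set_plus_mono2[of A' A "ksum k B'" "ksum k B"] ksum_mono[OF B'(1), of k] by (auto simp: A'_def)
    then have "x \<in> H.cell_sum k A"
      using cell_sum_critical[OF H.half_open_axioms assms(2)] by simp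
    then obtain a y where a: "a \<in> A" "y \<in> ksum k (H.cell a)" "x = a + y"
      unfolding H.cell_sum_def by blast
    have an: "a \<in> nonneg_span B" using a A_subset by blast
    define V where "V = H'.cell x"
    have Vb: "V \<in> bases B'" using H'.T_bases H'.cell(1)[OF xn] V_def by blast
    define W where "W = insert b V"
    note ind = basesD(2)[OF ins(1)[OF Vb], folded W_def] and bV = ins(2)[OF Vb]
    have "H.cell x = H.cell a"
      using H.cell_add[OF an] ksum_nonneg_span[OF H.TD(4)[OF H.cell(1)[OF an]], of k] a(2,3) by blast
    then have Wa: "H.cell a = W" using cells[OF xn] by (simp add: W_def V_def)
    have aW: "a \<in> nonneg_span W" using H.cell_nonneg_span[OF an] Wa by simp
    have aWs: "a \<in> span W" using aW nonneg_span_subset_span by blast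
    have "coord W x b = 0"
      using crd[OF Vb H'.in_span[OF xn], of b] bV by (simp add: W_def)
    then have "coord W a b + coord W y b = 0"
      using a(3) by (simp add: coord_linear_simps[OF ind])
    moreover have "coord W a b \<ge> 0"
      using aW nonneg_span_iff_coord[OF ind aWs] by (auto simp: W_def)
    moreover have "coord W y b \<ge> 0"
      using ksum_coord_Nats[OF ind, of y k b] a(2) Wa by (auto elim!: Nats_cases)
    ultimately have zero: "coord W a b = 0" "coord W y b = 0" by linarith+
    have yV: "y \<in> ksum k V"
    proof (cases k)
      case 0
      then show ?thesis using a(2) by simp
    next
      case (Suc j)
      have "y \<notin> (+) b ` ksum j W"
      proof
        assume "y \<in> (+) b ` ksum j W"
        then obtain z where z: "z \<in> ksum j W" "y = b + z" by blast
        have "coord W z b \<ge> 0" using ksum_coord_Nats[OF ind z(1), of b] by (auto elim!: Nats_cases)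
        moreover have "coord W b b = 1" using coord_basis[OF ind, of b b] by (simp add: W_def)
        ultimately show False using zero(2) z(2) by (simp add: coord_linear_simps[OF ind])
      qed
      moreover have "y \<in> ksum (Suc j) (insert b V)" using a(2) Wa Suc by (simp only: W_def)
      ultimately show ?thesis
        using ksum_insert[where k = j and v = b and V = V] unfolding Suc W_def by blast
    qed
    have aV: "a \<in> span V"
      using coord_eq_0_span[OF ind aWs, of V] zero(1) by (auto simp: W_def)
    have "coord V a v \<ge> 0" if "v \<in> V" for v
    proof -
      have "coord W a v = coord V a v"
        using coord_subset[OF ind _ aV, of v] that by (auto simp: W_def)
      then show ?thesis using aW nonneg_span_iff_coord[OF ind aWs] that by (auto simp: W_def)
    qed
    then have "a \<in> nonneg_span V"
      using nonneg_span_iff_coord[OF basesD(2)[OF Vb] aV] by blast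
    then have an': "a \<in> nonneg_span B'" using nonneg_span_mono[OF B'(4) basesD(1)[OF Vb]] by blast
    then have "insert b (H'.cell a) = insert b V" using cells[OF an'] Wa by (simp add: W_def)
    moreover have "b \<notin> H'.cell a" using ins(2) H'.T_bases H'.cell(1)[OF an'] by blast
    ultimately have "H'.cell a = V" using bV by (metis Diff_insert_absorb)
    moreover have "a \<in> A'" using a(1) an' by (simp add: A'_def)
    ultimately show ?thesis unfolding H'.cell_sum_def using a(3) yV by blast
  qed
  moreover have "B' \<subseteq> A'" using assms(1) B'(1) nonneg_span_base[OF B'(4)] by (auto simp: A'_def)
  ultimately have "lin_critical k A' B'"
    using P'.critical_cell_sum[OF H'.half_open_axioms] by blast
  then show ?thesis by (simp add: A'_def B'_def)
qed

lemma critical_remove: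
  assumes "B \<subseteq> A" "lin_critical k A B" "b \<in> B" "B - {b} \<noteq> {}"
  shows "lin_critical k (A \<inter> nonneg_span (B - {b})) (B - {b})"
proof (cases "b \<in> span (B - {b})")
  case True
  then have "span (B - {b}) = span B"
    using span_redundant[OF True] assms(3) by (simp add: insert_absorb)
  then show ?thesis using critical_remove_same_span assms by blast
qed (use critical_remove_apex assms in blast)

end

text \<open>Delete the points of \<open>B - C\<close> one at a time; \<open>A\<close>, cut down to
  the smaller cone, still contains the remaining points.\<close>

lemma (in sumset_pair) critical_subset:
  assumes "B \<subseteq> A" "lin_critical k A B" "C \<subseteq> B" "C \<noteq> {}"
  shows "lin_critical k (A \<inter> nonneg_span C) C"
proof -
  have "finite (B - C)" using finite_B by simp
  moreover have "lin_critical k (A \<inter> nonneg_span (B - D)) (B - D)"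
    if "finite D" "D \<subseteq> B - C" for D
    using that
  proof (induction D)
    case empty
    have "A \<inter> nonneg_span B = A" using A_subset by blast
    then show ?case using assms(2) by simp
  next
    case (insert b D)
    define B1 where "B1 = B - D"
    have B1: "B1 \<subseteq> B" "b \<in> B1" "B1 - {b} = B - insert b D" "B1 \<noteq> {}" "B1 - {b} \<noteq> {}"
      using insert.prems insert.hyps assms(3,4) by (auto simp: B1_def)
    interpret P: sumset_pair \<tau> "A \<inter> nonneg_span B1" B1 by (rule sumset_pair_subset[OF B1(1,4)])
    have "B1 \<subseteq> A \<inter> nonneg_span B1"
      using B1(1) assms(1) nonneg_span_base[OF P.finite_B] by blast
    then have "lin_critical k (A \<inter> nonneg_span B1 \<inter> nonneg_span (B1 - {b})) (B1 - {b})"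
      using P.critical_remove[of k b] insert B1 by (auto simp: B1_def)
    moreover have "A \<inter> nonneg_span B1 \<inter> nonneg_span (B1 - {b}) = A \<inter> nonneg_span (B1 - {b})"
      using nonneg_span_mono[OF P.finite_B, of "B1 - {b}"] by blast
    ultimately show ?case using B1(3) by simp
  qed
  ultimately show ?thesis
    using assms(3) by (metis double_diff subset_refl)
qed

section \<open>Homogenisation\<close>

definition homog :: "'a::euclidean_space \<Rightarrow> 'a \<times> real" where
  "homog x = (x, 1)"

lemma inj_homog: "inj_on homog S"
  by (auto simp: inj_on_def homog_def)



text \<open>All sums of \<open>k\<close> lifted points have last coordinate \<open>k\<close>, so
  lifting neither merges nor separates sums.\<close>

lemma ksum_homog: "ksum k (homog ` B) = (\<lambda>y. (y, real k)) ` ksum k B"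
proof (induction k)
  case 0
  then show ?case by (simp add: zero_prod_def)
next
  case (Suc k)
  have "(\<lambda>y. (y, real k)) ` S + homog ` B = (\<lambda>y. (y, real (Suc k))) ` (S + B)" for S
  proof
    show "(\<lambda>y. (y, real k)) ` S + homog ` B \<subseteq> (\<lambda>y. (y, real (Suc k))) ` (S + B)"
      by (force simp: set_plus_def homog_def)
    show "(\<lambda>y. (y, real (Suc k))) ` (S + B) \<subseteq> (\<lambda>y. (y, real k)) ` S + homog ` B"
      by (force simp: set_plus_def homog_def)
  qed
  then show ?case using Suc by simp
qed

lemma card_sumset_homog: "card (homog ` A + ksum k (homog ` B)) = card (A + ksum k B)"
proof -
  have "homog ` A + (\<lambda>y. (y, real k)) ` S = (\<lambda>y. (y, real (Suc k))) ` (A + S)" for S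
  proof
    show "homog ` A + (\<lambda>y. (y, real k)) ` S \<subseteq> (\<lambda>y. (y, real (Suc k))) ` (A + S)"
      by (force simp: set_plus_def homog_def)
    show "(\<lambda>y. (y, real (Suc k))) ` (A + S) \<subseteq> homog ` A + (\<lambda>y. (y, real k)) ` S"
      by (force simp: set_plus_def homog_def)
  qed
  then show ?thesis
    unfolding ksum_homog by (simp add: card_image inj_on_def)
qed

lemma sum_homog:
  "(\<Sum>v\<in>homog ` V. c v *\<^sub>R v) = ((\<Sum>v\<in>V. c (homog v) *\<^sub>R v), (\<Sum>v\<in>V. c (homog v)))"
  by (subst sum.reindex[OF inj_homog]) (simp add: homog_def o_def sum_prod)

lemma homog_nonneg_span_iff:
  assumes "finite B"
  shows "homog x \<in> nonneg_span (homog ` B) \<longleftrightarrow> x \<in> convex hull B"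
proof
  assume "homog x \<in> nonneg_span (homog ` B)"
  then obtain \<mu> where \<mu>: "\<forall>b\<in>homog ` B. 0 \<le> \<mu> b" "homog x = (\<Sum>b\<in>homog ` B. \<mu> b *\<^sub>R b)"
    by (auto simp: nonneg_span_def)
  then have "(\<Sum>v\<in>B. \<mu> (homog v) *\<^sub>R v) = x" "(\<Sum>v\<in>B. \<mu> (homog v)) = 1"
    unfolding sum_homog by (simp_all add: homog_def)
  then show "x \<in> convex hull B"
    unfolding convex_hull_finite[OF assms] using \<mu>(1) by (auto intro!: exI[of _ "\<lambda>v. \<mu> (homog v)"])
next
  assume "x \<in> convex hull B"
  then obtain u where u: "\<forall>b\<in>B. 0 \<le> u b" "sum u B = 1" "(\<Sum>b\<in>B. u b *\<^sub>R b) = x"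
    unfolding convex_hull_finite[OF assms] by auto
  have "homog x = (\<Sum>b\<in>homog ` B. u (fst b) *\<^sub>R b)"
    unfolding sum_homog using u by (simp add: homog_def)
  moreover have "\<forall>b\<in>homog ` B. 0 \<le> u (fst b)" using u(1) by (simp add: homog_def)
  ultimately show "homog x \<in> nonneg_span (homog ` B)"
    unfolding nonneg_span_def by (auto intro!: exI[of _ "\<lambda>b. u (fst b)"])
qed

text \<open>Dividing by the total coefficient, which is the last coordinate, brings a nonzero point
  of the cone to height 1.\<close>

lemma nonneg_span_homog_cases:
  assumes "finite B" "z \<in> nonneg_span (homog ` B)" "z \<noteq> 0"
  obtains s x where "s > 0" "x \<in> convex hull B" "z = s *\<^sub>R homog x"
proof -
  obtain \<mu> where \<mu>: "\<forall>b\<in>homog ` B. 0 \<le> \<mu> b" "z = (\<Sum>b\<in>homog ` B. \<mu> b *\<^sub>R b)"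
    using assms(2) by (auto simp: nonneg_span_def)
  define s where "s = (\<Sum>v\<in>B. \<mu> (homog v))"
  have "s \<noteq> 0"
  proof
    assume "s = 0"
    then have "\<forall>v\<in>B. \<mu> (homog v) = 0"
      using sum_nonneg_eq_0_iff[OF assms(1), of "\<lambda>v. \<mu> (homog v)"] \<mu>(1) by (auto simp: s_def)
    then have "z = 0" unfolding \<mu>(2) sum_homog by (simp add: zero_prod_def)
    then show False using assms(3) by simp
  qed
  moreover have "s \<ge> 0" unfolding s_def using \<mu>(1) by (auto intro: sum_nonneg)
  ultimately have s: "s > 0" by simp
  define x where "x = (1 / s) *\<^sub>R (\<Sum>v\<in>B. \<mu> (homog v) *\<^sub>R v)"
  have z: "z = s *\<^sub>R homog x"
    using s unfolding \<mu>(2) sum_homog by (simp add: x_def homog_def s_def)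
  then have "homog x = (1 / s) *\<^sub>R z" using s by simp
  then have "homog x \<in> nonneg_span (homog ` B)" using nonneg_span_scale[OF assms(2), of "1 / s"] s by simp
  then show ?thesis using that s z homog_nonneg_span_iff[OF assms(1)] by blast
qed

text \<open>The last coordinate of a relation between lifted points says that its coefficients sum
  to zero, as affine dependence demands.\<close>

lemma independent_homog_iff:
  assumes "finite V"
  shows "independent (homog ` V) \<longleftrightarrow> \<not> affine_dependent V"
proof -
  have "dependent (homog ` V) \<longleftrightarrow>
      (\<exists>c. (\<exists>v\<in>V. c (homog v) \<noteq> 0) \<and> (\<Sum>v\<in>V. c (homog v) *\<^sub>R v) = 0 \<and> (\<Sum>v\<in>V. c (homog v)) = 0)"
    unfolding dependent_finite[OF finite_imageI[OF assms]] sum_homog by (auto simp: zero_prod_def)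
  also have "\<dots> \<longleftrightarrow> (\<exists>U. sum U V = 0 \<and> (\<exists>v\<in>V. U v \<noteq> 0) \<and> (\<Sum>v\<in>V. U v *\<^sub>R v) = 0)"
  proof
    assume "\<exists>U. sum U V = 0 \<and> (\<exists>v\<in>V. U v \<noteq> 0) \<and> (\<Sum>v\<in>V. U v *\<^sub>R v) = 0"
    then obtain U where "sum U V = 0 \<and> (\<exists>v\<in>V. U v \<noteq> 0) \<and> (\<Sum>v\<in>V. U v *\<^sub>R v) = 0" by blast
    then show "\<exists>c. (\<exists>v\<in>V. c (homog v) \<noteq> 0) \<and> (\<Sum>v\<in>V. c (homog v) *\<^sub>R v) = 0 \<and> (\<Sum>v\<in>V. c (homog v)) = 0"
      by (intro exI[of _ "\<lambda>z. U (fst z)"]) (auto simp: homog_def)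
  next
    assume "\<exists>c. (\<exists>v\<in>V. c (homog v) \<noteq> 0) \<and> (\<Sum>v\<in>V. c (homog v) *\<^sub>R v) = 0 \<and> (\<Sum>v\<in>V. c (homog v)) = 0"
    then obtain c where "(\<exists>v\<in>V. c (homog v) \<noteq> 0) \<and> (\<Sum>v\<in>V. c (homog v) *\<^sub>R v) = 0 \<and> (\<Sum>v\<in>V. c (homog v)) = 0" by blast
    then show "\<exists>U. sum U V = 0 \<and> (\<exists>v\<in>V. U v \<noteq> 0) \<and> (\<Sum>v\<in>V. U v *\<^sub>R v) = 0"
      by (intro exI[of _ "\<lambda>z. c (homog z)"]) auto
  qed
  finally show ?thesis using affine_dependent_explicit_finite[OF assms] by simp
qed

lemma dim_homog: "int (dim (homog ` B)) = aff_dim B + 1"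
proof -
  obtain V where V: "V \<subseteq> B" "\<not> affine_dependent V" "affine hull B = affine hull V"
    using affine_basis_exists[of B] by blast
  have fin: "finite V" using V aff_independent_finite by blast
  have "homog b \<in> span (homog ` V)" if "b \<in> B" for b
  proof -
    have "b \<in> affine hull V" using that V(3) hull_inc by metis
    then obtain u where u: "sum u V = 1" "(\<Sum>v\<in>V. u v *\<^sub>R v) = b" unfolding affine_hull_finite[OF fin] by auto
    have "homog b = (\<Sum>v\<in>homog ` V. u (fst v) *\<^sub>R v)"
      unfolding sum_homog using u by (simp add: homog_def)
    also have "\<dots> \<in> span (homog ` V)" by (intro span_sum span_scale span_base)
    finally show ?thesis .
  qed
  then have "dim (homog ` B) = card (homog ` V)"
    using V(1,2) independent_homog_iff[OF fin] by (intro dim_unique) auto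
  also have "\<dots> = card V" by (rule card_image[OF inj_homog])
  finally show ?thesis
    using aff_dim_affine_independent[OF V(2)] V(3) aff_dim_affine_hull[of B] aff_dim_affine_hull[of V] by simp
qed

lemma sumset_pair_homog:
  assumes "finite A" "finite B" "B \<noteq> {}" "A \<subseteq> convex hull B"
  shows "sumset_pair snd (homog ` A) (homog ` B)"
  unfolding sumset_pair_def
proof (intro conjI allI impI)
  show "linear (snd :: 'a \<times> real \<Rightarrow> real)" by (rule linear_snd)
  show "homog ` A \<subseteq> nonneg_span (homog ` B)"
    using homog_nonneg_span_iff[OF assms(2)] assms(4) by blast
qed (use assms in \<open>auto simp: homog_def\<close>)

lemma k_critical_homog_iff:
  "k_critical k A B \<longleftrightarrow> finite A \<and> finite B \<and> B \<noteq> {} \<and> A \<subseteq> convex hull B \<and> lin_critical k (homog ` A) (homog ` B)"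
proof -
  have "nat (aff_dim B) = dim (homog ` B) - 1" using dim_homog[of B] by linarith
  then show ?thesis
    unfolding k_critical_def lin_critical_def card_sumset_homog card_image[OF inj_homog] Let_def critical_size_def
      aff_dim_affine_hull by simp
qed

section \<open>Criticality on faces, and points of \<open>B\<close> on edges\<close>

lemma k_critical_subset:
  assumes "k_critical k A B" "B \<subseteq> A" "C \<subseteq> B" "C \<noteq> {}"
  shows "k_critical k (A \<inter> convex hull C) C"
proof -
  have AB: "finite A" "finite B" "B \<noteq> {}" "A \<subseteq> convex hull B" "lin_critical k (homog ` A) (homog ` B)"
    using assms(1) by (auto simp: k_critical_homog_iff)
  interpret sumset_pair snd "homog ` A" "homog ` B" by (rule sumset_pair_homog[OF AB(1-4)])
  have fin: "finite C" using assms(3) AB(2) finite_subset by blast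
  have "lin_critical k (homog ` A \<inter> nonneg_span (homog ` C)) (homog ` C)"
    using critical_subset[OF _ AB(5), of "homog ` C"] assms by (auto simp: image_mono)
  moreover have "homog ` A \<inter> nonneg_span (homog ` C) = homog ` (A \<inter> convex hull C)"
    using homog_nonneg_span_iff[OF fin] by auto
  ultimately show ?thesis using fin AB assms(4) by (auto simp: k_critical_homog_iff)
qed

text \<open>Segments ending at a relative interior point extend beyond it. After lifting, a small
  multiple of any vector of the cone can be subtracted from \<open>homog b\<close>, which is
  impossible from lifted dimension three on.\<close>

lemma k_critical_interior_vertex:
  assumes "k_critical k A B" "k \<ge> 1" "B \<subseteq> A" "b \<in> B" "b \<in> rel_interior (convex hull B)"
  shows "aff_dim B \<le> 1"
proof (rule ccontr)
  assume dim: "\<not> ?thesis"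
  have AB: "finite A" "finite B" "B \<noteq> {}" "A \<subseteq> convex hull B" "lin_critical k (homog ` A) (homog ` B)"
    using assms(1) by (auto simp: k_critical_homog_iff)
  interpret sumset_pair snd "homog ` A" "homog ` B" by (rule sumset_pair_homog[OF AB(1-4)])
  have d3: "dim (homog ` B) \<ge> 3" using dim_homog[of B] dim by linarith
  have "\<exists>d>0. homog b - d *\<^sub>R z \<in> nonneg_span (homog ` B)" if z: "z \<in> nonneg_span (homog ` B)" for z
  proof (cases "z = 0")
    case True
    then show ?thesis using nonneg_span_base[OF finite_B, of "homog b"] assms(4) by (auto intro!: exI[of _ 1])
  next
    case False
    then obtain s x where s: "s > 0" "x \<in> convex hull B" "z = s *\<^sub>R homog x"
      using nonneg_span_homog_cases[OF AB(2) z] by blast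
    obtain e where e: "e > 1" "(1 - e) *\<^sub>R x + e *\<^sub>R b \<in> convex hull B"
      using assms(5) convex_rel_interior_iff[of "convex hull B" b] s(2) AB(3) by auto
    define y where "y = (1 - e) *\<^sub>R x + e *\<^sub>R b"
    \<comment> \<open>Solve \<open>y = (1 - e) x + e b\<close> for \<open>b\<close>, and account for
      the height \<open>s\<close> of \<open>z\<close>.\<close>
    define d where "d = (e - 1) / (e * s)"
    have "d > 0" using e s by (simp add: d_def)
    have "homog b - d *\<^sub>R z = homog b - ((e - 1) / e) *\<^sub>R homog x"
      using s e by (simp add: d_def)
    also have "\<dots> = (1 / e) *\<^sub>R homog y"
    proof -
      have "homog y = (1 - e) *\<^sub>R homog x + e *\<^sub>R homog b"
        by (simp add: homog_def y_def)
      then have "(1 / e) *\<^sub>R homog y = ((1 - e) / e) *\<^sub>R homog x + homog b"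
        using e by (simp add: scaleR_right_distrib)
      moreover have "((1 - e) / e) = - ((e - 1) / e)" by (simp add: minus_divide_left)
      ultimately show ?thesis by (simp only: scaleR_minus_left) simp
    qed
    also have "\<dots> \<in> nonneg_span (homog ` B)"
      using e homog_nonneg_span_iff[OF AB(2), of y] by (intro nonneg_span_scale) (auto simp: y_def)
    finally show ?thesis using \<open>d > 0\<close> by blast
  qed
  then show False
    using critical_no_interior_vertex[OF image_mono[OF assms(3)] AB(5) assms(2) d3 imageI[OF assms(4)]] by blast
qed

text \<open>Descend through the faces containing \<open>b\<close>. Criticality passes to the points
  on the face, so \<open>b\<close> is not in the relative interior of a face of dimension at least
  two; it lies on a facet, again of dimension at least one.\<close>

lemma k_critical_face_edge:
  assumes "k_critical k A B" "k \<ge> 1" "B \<subseteq> A" "b \<in> B"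
    and "F face_of convex hull B" "b \<in> F" "aff_dim F \<ge> 1"
  shows "\<exists>e. e edge_of convex hull B \<and> b \<in> e"
  using assms(5-7)
proof (induction "nat (aff_dim F)" arbitrary: F rule: less_induct)
  case less
  have fin: "finite B" using assms(1) by (auto simp: k_critical_homog_iff)
  show ?case
  proof (cases "aff_dim F = 1")
    case True
    then show ?thesis using less.prems by (auto simp: edge_of_def)
  next
    case False
    obtain C where C: "C \<subseteq> B" "F = convex hull C"
      using face_of_convex_hull_subset[OF finite_imp_compact[OF fin] less.prems(1)] by blast
    \<comment> \<open>The generating set \<open>C\<close> may miss \<open>b\<close>, so all points
      of \<open>B\<close> on the face are taken.\<close>
    define D where "D = B \<inter> F"
    have "C \<subseteq> D" using C hull_subset[of C convex] by (auto simp: D_def)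
    moreover have "convex hull D \<subseteq> F"
      using face_of_imp_convex[OF less.prems(1)] by (intro hull_minimal) (auto simp: D_def)
    ultimately have F: "F = convex hull D" using C(2) hull_mono[of C D convex] by blast
    have D: "D \<subseteq> B" "b \<in> D" using assms(4) less.prems by (auto simp: D_def)
    have "k_critical k (A \<inter> convex hull D) D"
      using k_critical_subset[OF assms(1,3)] D by blast
    moreover have "D \<subseteq> A \<inter> convex hull D" using D(1) assms(3) hull_subset[of D convex] by blast
    moreover have "aff_dim D > 1" using False less.prems(3) F aff_dim_convex_hull[of D] by simp
    ultimately have "b \<notin> rel_interior F"
      using k_critical_interior_vertex[of k "A \<inter> convex hull D" D b] assms(2) D(2) F by force
    moreover have poly: "polyhedron F"
      unfolding F using D(1) fin finite_subset polyhedron_convex_hull by blast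
    ultimately have "b \<in> rel_frontier F"
      using less.prems(2) closure_subset by (auto simp: rel_frontier_def)
    then obtain G where G: "G facet_of F" "b \<in> G" using rel_frontier_of_polyhedron[OF poly] by blast
    have "G face_of convex hull B" using G(1) less.prems(1) face_of_trans by (auto simp: facet_of_def)
    moreover have "aff_dim G \<ge> 1" "nat (aff_dim G) < nat (aff_dim F)"
      using G(1) False less.prems(3) by (auto simp: facet_of_def)
    ultimately show ?thesis using less.hyps G(2) by blast
  qed
qed

section \<open>Simplicial complexes as tilings of the lifted cone\<close>

lemma simplex_vertices:
  assumes "simplicial_complex T" "{v. {v} \<in> T} = B" "S \<in> T"
  defines "C \<equiv> {v. v extreme_point_of S}"
  shows "\<not> affine_dependent C" "S = convex hull C" "C \<subseteq> B" "finite C" "int (card C) = aff_dim S + 1"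
proof -
  obtain n D where D: "\<not> affine_dependent D" "int (card D) = n + 1" "S = convex hull D"
    using assms(1,3) unfolding simplicial_complex_def simplex_def by blast
  have "C = D" unfolding C_def D(3) using extreme_point_of_convex_hull_affine_independent[OF D(1)] by blast
  then show "\<not> affine_dependent C" "S = convex hull C" "finite C"
    using D aff_independent_finite by auto
  then show "int (card C) = aff_dim S + 1"
    using affine_independent_iff_card[of C] by (simp add: aff_dim_convex_hull)
  show "C \<subseteq> B"
  proof
    fix v assume "v \<in> C"
    then have "{v} face_of S" by (simp add: C_def face_of_singleton)
    then have "{v} \<in> T" using assms(1,3) unfolding simplicial_complex_def by blast
    then show "v \<in> B" using assms(2) by blast
  qed
qed

lemma pos_homog_rel_interior:
  assumes "\<not> affine_dependent C" "homog y \<in> span (homog ` C)" "pos (homog ` C) (homog y)"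
  shows "y \<in> rel_interior (convex hull C)"
proof -
  have fin: "finite C" using assms(1) aff_independent_finite by blast
  have ind: "independent (homog ` C)" using independent_homog_iff[OF fin] assms(1) by simp
  define u where "u v = coord (homog ` C) (homog y) (homog v)" for v
  have "homog y = (\<Sum>v\<in>homog ` C. coord (homog ` C) (homog y) v *\<^sub>R v)"
    using coord_expand[OF ind assms(2)] by simp
  then have "(\<Sum>v\<in>C. u v *\<^sub>R v) = y" "sum u C = 1"
    unfolding sum_homog by (simp_all add: homog_def u_def)
  moreover have "\<forall>v\<in>C. 0 < u v" using assms(3) by (auto simp: pos_def u_def)
  ultimately show ?thesis
    unfolding rel_interior_convex_hull_explicit[OF assms(1)] by blast
qed

definition homog_cells :: "'a::euclidean_space set set \<Rightarrow> 'a set \<Rightarrow> ('a \<times> real) set set" where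
  "homog_cells T B = (\<lambda>S. homog ` {v. v extreme_point_of S}) ` {S \<in> T. aff_dim S = aff_dim (convex hull B)}"

text \<open>A generic point, brought to height 1, lies in some simplex, full-dimensional by
  genericity. A common point of two open cones gives a relative interior point of both simplices;
  their intersection is a face of each, hence equal to both.\<close>

lemma triangulates_homog_cells:
  assumes "finite B" "B \<noteq> {}" "triangulation_of T B"
  shows "triangulates (homog ` B) (homog_cells T B)"
proof -
  define C where "C S = {v. v extreme_point_of S}" for S :: "'a set"
  have T: "simplicial_complex T" "{v. {v} \<in> T} = B" "\<Union>T = convex hull B"
    using assms(3) by (auto simp: triangulation_of_def)
  note sv = simplex_vertices[OF T(1,2), folded C_def]
  have ind: "independent (homog ` C S)" if "S \<in> T" for S
    using independent_homog_iff[OF sv(4)[OF that]] sv(1)[OF that] by simp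
  have cardC: "int (card (homog ` C S)) = aff_dim S + 1" if "S \<in> T" for S
    using card_image[OF inj_homog] sv(5)[OF that] by metis
  have bas: "homog ` C S \<in> bases (homog ` B)" if S: "S \<in> T" "aff_dim S = aff_dim (convex hull B)" for S
  proof -
    have sub: "homog ` C S \<subseteq> homog ` B" using sv(3)[OF S(1)] by (rule image_mono)
    have "card (homog ` C S) = dim (homog ` B)"
      using cardC[OF S(1)] S(2) dim_homog[of B] by (simp add: aff_dim_convex_hull)
    then have "homog ` B \<subseteq> span (homog ` C S)"
      using card_eq_dim[OF sub _ finite_imageI[OF sv(4)[OF S(1)]]] ind[OF S(1)] by blast
    then have "span (homog ` C S) = span (homog ` B)"
      using span_mono[OF sub] span_minimal[of "homog ` B" "span (homog ` C S)"] by auto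
    then show ?thesis using ind[OF S(1)] sub by (simp add: bases_def)
  qed
  have cover: "\<exists>V\<in>homog_cells T B. pos V z" if z: "z \<in> nonneg_span (homog ` B)" "generic (homog ` B) z" for z
  proof -
    \<comment> \<open>The zero vector is not generic, as every lifted point of \<open>B\<close>
      belongs to a basis.\<close>
    have "z \<noteq> 0"
    proof
      assume "z = 0"
      obtain b where "b \<in> B" using assms(2) by blast
      have "independent {homog b}" by (simp add: homog_def zero_prod_def)
      then obtain W where W: "{homog b} \<subseteq> W" "W \<in> bases (homog ` B)"
        using independent_extend_bases[of "{homog b}" "homog ` B"] \<open>b \<in> B\<close> by blast
      then have "coord W z (homog b) \<noteq> 0" using z(2) by (auto simp: generic_def)
      then show False using \<open>z = 0\<close> coord_linear_simps(5)[OF basesD(2)[OF W(2)]] by simp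
    qed
    then obtain s x where s: "s > 0" "x \<in> convex hull B" "z = s *\<^sub>R homog x"
      using nonneg_span_homog_cases[OF assms(1) z(1)] by blast
    then obtain S where S: "S \<in> T" "x \<in> S" using T(3) by blast
    have "homog x \<in> nonneg_span (homog ` C S)"
      using homog_nonneg_span_iff[OF sv(4)[OF S(1)]] S(2) sv(2)[OF S(1)] by simp
    then have "z \<in> nonneg_span (homog ` C S)" using nonneg_span_scale s by fastforce
    then have V: "homog ` C S \<in> bases (homog ` B)" "pos (homog ` C S) z"
      using generic_nonneg_span_pos[OF z(2) ind[OF S(1)] image_mono[OF sv(3)[OF S(1)]]] by blast+
    have "aff_dim S = aff_dim (convex hull B)"
      using basesD(5)[OF V(1)] cardC[OF S(1)] dim_homog[of B] by (simp add: aff_dim_convex_hull)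
    then have "homog ` C S \<in> homog_cells T B" using S(1) by (auto simp: homog_cells_def C_def)
    then show ?thesis using V(2) by blast
  qed
  have inter: "S = S'"
    if S: "S \<in> T" "S' \<in> T" "aff_dim S = aff_dim (convex hull B)" "aff_dim S' = aff_dim (convex hull B)"
      and z: "z \<in> span (homog ` B)" "pos (homog ` C S) z" "pos (homog ` C S') z" for S S' z
  proof -
    have zS: "z \<in> nonneg_span (homog ` C S)"
      using z nonneg_span_iff_coord[OF ind[OF S(1)], of z] basesD(3)[OF bas[OF S(1,3)]] by (force simp: pos_def)
    have "C S \<noteq> {}"
    proof
      assume "C S = {}"
      then have "S = {}" using sv(2)[OF S(1)] by simp
      then show False using S(3) assms(2) aff_dim_empty[of B] by (simp add: aff_dim_convex_hull)
    qed
    then have "z \<noteq> 0"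
      using z(2) coord_linear_simps(5)[OF ind[OF S(1)]] unfolding pos_def by (metis all_not_in_conv image_is_empty less_irrefl)
    then obtain s y where s: "s > 0" "z = s *\<^sub>R homog y"
      using nonneg_span_homog_cases[OF sv(4)[OF S(1)] zS] by blast
    have hy: "homog y = (1 / s) *\<^sub>R z" using s by simp
    then have ysp: "homog y \<in> span (homog ` B)" using z(1) span_scale by metis
    have ri: "y \<in> rel_interior R" if R: "R \<in> T" "aff_dim R = aff_dim (convex hull B)" "pos (homog ` C R) z" for R
    proof -
      have "pos (homog ` C R) (homog y)"
        using R(3) s(1) unfolding hy by (simp add: pos_def coord_linear_simps[OF ind[OF R(1)]])
      then have "y \<in> rel_interior (convex hull (C R))"
        using pos_homog_rel_interior[OF sv(1)[OF R(1)]] ysp basesD(3)[OF bas[OF R(1,2)]] by blast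
      then show ?thesis using sv(2)[OF R(1)] by simp
    qed
    have y: "y \<in> rel_interior S" "y \<in> rel_interior S'" using ri S z by blast+
    then have yS: "y \<in> S \<inter> S'" using rel_interior_subset by blast
    have faces: "S \<inter> S' face_of S" "S' \<inter> S face_of S'" using T(1) S(1,2) unfolding simplicial_complex_def by blast+
    have "S \<inter> S' = S" using face_of_disjoint_rel_interior[OF faces(1)] y(1) yS by blast
    moreover have "S' \<inter> S = S'" using face_of_disjoint_rel_interior[OF faces(2)] y(2) yS by blast
    ultimately show ?thesis by blast
  qed
  show ?thesis
    unfolding triangulates_def
  proof (intro conjI ballI impI)
    show "homog_cells T B \<subseteq> bases (homog ` B)" using bas by (auto simp: homog_cells_def C_def)
  next
    fix V W z
    assume "V \<in> homog_cells T B" "W \<in> homog_cells T B" and z: "z \<in> span (homog ` B)" "pos V z \<and> pos W z"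
    then obtain S S' where "S \<in> T" "S' \<in> T" "aff_dim S = aff_dim (convex hull B)" "aff_dim S' = aff_dim (convex hull B)"
      and VW: "V = homog ` C S" "W = homog ` C S'"
      by (auto simp: homog_cells_def C_def)
    then have "S = S'" using inter z by blast
    then show "V = W" using VW by simp
  qed (use cover in blast)
qed

text \<open>Each \<open>{b}\<close> is a simplex of the complex, so it is a face of any simplex
  containing \<open>b\<close>; this is the vertex condition of the cell count. Simplices are
  determined by their vertices, so cells and full-dimensional simplices are equinumerous.\<close>

lemma k_critical_totally_stackable:
  assumes "k_critical k A B" "k \<ge> 1" "B \<subseteq> A"
  shows "totally_stackable B"
  unfolding totally_stackable_def
proof (intro allI impI)
  fix T assume tri: "triangulation_of T B"
  have AB: "finite A" "finite B" "B \<noteq> {}" "A \<subseteq> convex hull B" "lin_critical k (homog ` A) (homog ` B)"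
    using assms(1) by (auto simp: k_critical_homog_iff)
  interpret sumset_pair snd "homog ` A" "homog ` B" by (rule sumset_pair_homog[OF AB(1-4)])
  have T: "simplicial_complex T" "{v. {v} \<in> T} = B" "\<Union>T = convex hull B"
    using tri by (auto simp: triangulation_of_def)
  note sv = simplex_vertices[OF T(1,2)]
  have vert: "z \<in> V" if V: "V \<in> homog_cells T B" and z: "z \<in> homog ` B" "z \<in> nonneg_span V" for V z
  proof -
    obtain S where S: "S \<in> T" "V = homog ` {v. v extreme_point_of S}"
      using V by (auto simp: homog_cells_def)
    obtain b where b: "b \<in> B" "z = homog b" using z(1) by blast
    have "b \<in> S" using z(2) homog_nonneg_span_iff[OF sv(4)[OF S(1)]] sv(2)[OF S(1)] S(2) b(2) by simp
    moreover have "{b} \<in> T" using b(1) T(2) by blast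
    ultimately have "{b} face_of S"
      using T(1) S(1) unfolding simplicial_complex_def by (metis Int_insert_right_if1 Int_empty_right)
    then show ?thesis using b(2) S(2) by (simp add: face_of_singleton)
  qed
  have "inj_on (\<lambda>S. homog ` {v. v extreme_point_of S}) {S \<in> T. aff_dim S = aff_dim (convex hull B)}"
  proof
    fix S S' assume S: "S \<in> {S \<in> T. aff_dim S = aff_dim (convex hull B)}" "S' \<in> {S \<in> T. aff_dim S = aff_dim (convex hull B)}"
      and eq: "homog ` {v. v extreme_point_of S} = homog ` {v. v extreme_point_of S'}"
    have "{v. v extreme_point_of S} = {v. v extreme_point_of S'}"
      using iffD1[OF inj_image_eq_iff[OF inj_homog] eq] .
    then show "S = S'" using sv(2)[of S] sv(2)[of S'] S by simp
  qed
  then have "card {S \<in> T. aff_dim S = aff_dim (convex hull B)} = card (homog_cells T B)"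
    unfolding homog_cells_def by (rule card_image[symmetric])
  moreover have "int (card (homog_cells T B)) = int (card (homog ` B)) - (int (dim (homog ` B)) - 1)"
    using critical_card_triangulation[OF image_mono[OF assms(3)] AB(5) assms(2) triangulates_homog_cells[OF AB(2,3) tri]] vert
    by blast
  ultimately show "stacked_triangulation T B"
    unfolding stacked_triangulation_def using tri dim_homog[of B] card_image[OF inj_homog, of B]
    by (simp add: aff_dim_convex_hull)
qed

section \<open>Deduction of the four claims\<close>

theorem theorem6p6:
  fixes A B :: "(real ^ 'd) set" and k :: nat
  assumes "finite A" and "finite B"
    and "A \<subseteq> convex hull B"
    and "aff_dim (convex hull B) = int CARD('d)"
    and "k \<ge> 2"
    and "k_critical k A B"
  shows "B \<subseteq> A
    \<and> (\<forall>B'. B' \<noteq> {} \<and> B' \<subseteq> B \<longrightarrow> k_critical k (A \<inter> convex hull B') B')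
    \<and> (totally_stackable B \<and> B \<subseteq> \<Union>{e. e edge_of (convex hull B)})
    \<and> (k_critical 1 A B \<and>
       real (card (A + B)) =
         (real CARD('d) + 1) * real (card A) - real CARD('d) * (real CARD('d) + 1) / 2)"
proof -
  have AB: "B \<noteq> {}" "lin_critical k (homog ` A) (homog ` B)"
    using assms(6) by (auto simp: k_critical_homog_iff)
  interpret sumset_pair snd "homog ` A" "homog ` B" by (rule sumset_pair_homog[OF assms(1,2) AB(1) assms(3)])
  have aff: "aff_dim B = int CARD('d)" using assms(4) by (simp add: aff_dim_convex_hull)
  have d1: "CARD('d) \<ge> 1" by (simp add: Suc_leI)
  have "dim (homog ` B) \<ge> 2" using dim_homog[of B] aff d1 by linarith
  then have sub: "homog ` B \<subseteq> homog ` A"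
    using critical_vertices_subset[OF AB(2)] assms(5) by simp
  then have BA: "B \<subseteq> A" using inj_image_subset_iff[OF inj_homog[of UNIV]] by blast
  \<comment> \<open>Downward induction from \<open>k\<close>, removing one summand at a
    time.\<close>
  have "lin_critical j (homog ` A) (homog ` B)" if "j \<le> k" for j
    using that AB(2) by (induction rule: inc_induct) (auto intro: critical_decrease[OF sub])
  then have crit1: "k_critical 1 A B"
    using assms AB(1) by (simp add: k_critical_homog_iff)
  have edges: "B \<subseteq> \<Union>{e. e edge_of (convex hull B)}"
  proof
    fix b assume b: "b \<in> B"
    then have "b \<in> convex hull B" by (rule hull_inc)
    \<comment> \<open>The descent through faces starts from the hull itself, whose dimension is
      positive.\<close>
    then show "b \<in> \<Union>{e. e edge_of (convex hull B)}"
      using k_critical_face_edge[OF assms(6) _ BA b face_of_refl[OF convex_convex_hull]] assms(4,5) d1 by auto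
  qed
  \<comment> \<open>For one summand in dimension \<open>d\<close> the subtracted constant is
    \<open>d + 1\<close> choose 2.\<close>
  have "int (card (A + B)) = int (Suc CARD('d)) * int (card A) - int (Suc CARD('d) choose 2)"
    using crit1 aff by (simp add: k_critical_def Let_def aff_dim_affine_hull numeral_2_eq_2)
  then have "real (card (A + B)) = real (Suc CARD('d)) * real (card A) - real (Suc CARD('d) choose 2)"
    by (metis of_int_diff of_int_mult of_int_of_nat_eq)
  moreover have "2 * real (Suc CARD('d) choose 2) = real CARD('d) * (real CARD('d) + 1)"
  proof -
    have "2 * (Suc CARD('d) choose 2) = Suc CARD('d) * CARD('d)"
      using binomial_absorption[of 1 "Suc CARD('d)"] by (simp add: numeral_2_eq_2)
    then have "real (2 * (Suc CARD('d) choose 2)) = real (Suc CARD('d) * CARD('d))" by (simp only:)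
    then show ?thesis by (simp add: algebra_simps)
  qed
  ultimately have card: "real (card (A + B)) =
      (real CARD('d) + 1) * real (card A) - real CARD('d) * (real CARD('d) + 1) / 2"
    by (simp add: field_simps)
  show ?thesis
    using BA k_critical_subset[OF assms(6) BA] k_critical_totally_stackable[OF assms(6) _ BA] edges crit1 card assms(5)
    by auto
qed

end
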